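(* Let $\mathbb{T}_0=e_0((\mathbb{R}/2\pi\mathbb{Z})^m)\subset\mathbb{R}^M$ be a smooth embedded (quasi-)periodic reducible normally hyperbolic invariant torus for the smooth vector field ${\bf F}_0:\mathbb{R}^M\to\mathbb{R}^M$, with frequency vector $\omega\in\mathbb{R}^m$, family of injective linear maps $N$, and hyperbolic Floquet matrix $L$ (see context). Let ${\bf F}_1,{\bf F}_2,\ldots:\mathbb{R}^M\to\mathbb{R}^M$ be smooth, and consider the iterative equations $\mathfrak{c}(e_j,{\bf f}_j)={\bf G}_j$, $j=1,2,\ldots$, for smooth unknowns $e_j:(\mathbb{R}/2\pi\mathbb{Z})^m\to\mathbb{R}^M$ and ${\bf f}_j:(\mathbb{R}/2\pi\mathbb{Z})^m\to\mathbb{R}^m$, where $\mathfrak{c}$ and ${\bf G}_j$ are defined in the context. Write $e_j=e_0'\cdot{\bf g}_j+N\cdot{\bf h}_j$ with ${\bf g}_j:(\mathbb{R}/2\pi\mathbb{Z})^m\to\mathbb{R}^m$ (tangential component) and ${\bf h}_j:(\mathbb{R}/2\pi\mathbb{Z})^m\to\mathbb{R}^{M-m}$ (normal component). Then: (i) There exist smooth solutions $(e_j,{\bf f}_j)$ to $\mathfrak{c}(e_j,{\bf f}_j)={\bf G}_j$ for every $j\in\mathbb{N}$. They are given explicitly, in terms of Fourier coefficients, by $$f_{j,k}=U_{j,k}-i\langle\omega,k\rangle g_{j,k},\qquad h_{j,k}=(i\langle\omega,k\rangle-L)^{-1}V_{j,k}\qquad\text{for all }k\in\mathbb{Z}^m,$$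 where $f_{j,k},g_{j,k},h_{j,k},U_{j,k},V_{j,k}$ are the $k$-th Fourier coefficients of ${\bf f}_j,{\bf g}_j,{\bf h}_j,U_j,V_j$. (ii) The tangential component ${\bf g}_j$ of each $e_j$ can be chosen freely as an arbitrary smooth function, but every such choice for $e_1,\ldots,e_{j-1}$ (that is, of ${\bf g}_1,\ldots,{\bf g}_{j-1}$) uniquely determines the normal component ${\bf h}_j$ of $e_j$. (iii) For every $j$ and every finite $K\in\mathbb{N}$, the tangential component ${\bf g}_j$ of $e_j$ can be chosen in such a way that ${\bf f}_j$ is in normal form to order $K$ in its Fourier expansion.
   Context: Smooth means $C^\infty$. For $\omega\in\mathbb{R}^m$ and a smooth map $A$ on $(\mathbb{R}/2\pi\mathbb{Z})^m$, $\partial_\omega A:=A'\cdot\omega=\frac{d}{ds}|_{s=0}A(\cdot+s\omega)$. Embedded (quasi-)periodic invariant torus: $e_0:(\mathbb{R}/2\pi\mathbb{Z})^m\to\mathbb{R}^M$ is a smooth embedding with $\partial_\omega e_0={\bf F}_0\circ e_0$. Reducible: there are a smooth family of linear maps $N:(\mathbb{R}/2\pi\mathbb{Z})^m\to\mathcal{L}(\mathbb{R}^{M-m},\mathbb{R}^M)$ and a linear map $L:\mathbb{R}^{M-m}\to\mathbb{R}^{M-m}$ such that (a) $\mathbb{R}^M=\mathrm{im}\,e_0'(\phi)\oplus\mathrm{im}\,N(\phi)$ for every $\phi$ (so every $N(\phi)$ is injective), and (b) the map $(\phi,u)\mapsto(e_0(\phi),N(\phi)\cdot u)$ sends solution curves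 of $\dot\phi=\omega,\ \dot u=L\cdot u$ on $(\mathbb{R}/2\pi\mathbb{Z})^m\times\mathbb{R}^{M-m}$ to integral curves of the vector field $(x,v)\mapsto({\bf F}_0(x),{\bf F}_0'(x)\cdot v)$ on $\mathbb{R}^M\times\mathbb{R}^M$. $L$ is called a Floquet matrix. Normal hyperbolicity is understood as $L$ being hyperbolic, i.e. $L$ has no eigenvalues on the imaginary axis. The iterative equations arise by inserting $e=e_0+\varepsilon e_1+\varepsilon^2e_2+\ldots$, ${\bf f}=\omega+\varepsilon{\bf f}_1+\varepsilon^2{\bf f}_2+\ldots$ and ${\bf F}={\bf F}_0+\varepsilon{\bf F}_1+\varepsilon^2{\bf F}_2+\ldots$ in the conjugacy equation $e'\cdot{\bf f}-{\bf F}\circ e=0$. Here $$\mathfrak{c}(e_j,{\bf f}_j):=(\partial_\omega-{\bf F}_0'\circ e_0)\cdot e_j+e_0'\cdot{\bf f}_j,$$ $${\bf G}_j:=\frac{1}{j!}\frac{d^j}{d\varepsilon^j}\Big|_{\varepsilon=0}\Big[({\bf F}_0+\varepsilon{\bf F}_1+\ldots+\varepsilon^j{\bf F}_j)(e_0+\varepsilon e_1+\ldots+\varepsilon^{j-1}e_{j-1})-(e_0+\varepsilon e_1+\ldots+\varepsilon^{j-1}e_{j-1})'\cdot(\omega+\varepsilon{\bf f}_1+\ldots+\varepsilon^{j-1}{\bf f}_{j-1})\Big],$$ so ${\bf G}_j$ depends only on ${\bf F}_0,\ldots,{\bf F}_j$, $e_0,\ldots,e_{j-1}$, $\omega$ and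 ${\bf f}_1,\ldots,{\bf f}_{j-1}$. Let $\pi(\phi):\mathbb{R}^M\to\mathbb{R}^M$ be the projection with $\pi(\phi)\cdot e_0'(\phi)=e_0'(\phi)$ and $\pi(\phi)\cdot N(\phi)=0$. For an injective linear map $A$ write $A^+:=(A^TA)^{-1}A^T$. Define $U_j:=(e_0')^+\cdot\pi\cdot{\bf G}_j$ and $V_j:=N^+\cdot(1-\pi)\cdot{\bf G}_j$. Fourier series are written ${\bf A}(\phi)=\sum_{k\in\mathbb{Z}^m}A_ke^{i\langle k,\phi\rangle}$ with $\langle k,\phi\rangle=k_1\phi_1+\ldots+k_m\phi_m$, and $|k|=(|k_1|^2+\ldots+|k_m|^2)^{1/2}$. ${\bf f}_j$ is in normal form to order $K\in\mathbb{N}\cup\{\infty\}$ in its Fourier expansion if $f_{j,k}=0$ for all $k\in\mathbb{Z}^m$ with $\langle\omega,k\rangle\neq0$ and $|k|\le K$. *)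

theory Defs
  imports "HOL-Analysis.Analysis" "HOL-Library.Extended_Real"
begin

text \<open>Smoothness on all of a Euclidean space: a map is of class \<open>C\<^sup>k\<^sup>+\<^sup>1\<close> iff it is
  differentiable and each of its directional derivatives is of class \<open>C\<^sup>k\<close>.\<close>

primrec Ck :: "nat \<Rightarrow> ('a::euclidean_space \<Rightarrow> 'b::euclidean_space) \<Rightarrow> bool" where
  "Ck 0 f = continuous_on UNIV f"
| "Ck (Suc k) f = ((\<forall>x. f differentiable (at x)) \<and>
                   (\<forall>v. Ck k (\<lambda>x. frechet_derivative f (at x) v)))"

definition smooth :: "('a::euclidean_space \<Rightarrow> 'b::euclidean_space) \<Rightarrow> bool" where
  "smooth f \<longleftrightarrow> (\<forall>k. Ck k f)"

text \<open>Maps on the torus \<open>(\<real>/2\<pi>\<int>)\<^sup>m\<close> are represented by maps on \<open>\<real>\<^sup>m\<close> that are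
  \<open>2\<pi>\<close>-periodic in every coordinate; \<open>m\<close> is the cardinality of the index type.\<close>

definition ivec :: "int^'m::finite \<Rightarrow> real^'m" where
  "ivec k = (\<chi> i. real_of_int (k $ i))"

definition torus_smooth :: "(real^'m::finite \<Rightarrow> 'b::euclidean_space) \<Rightarrow> bool" where
  "torus_smooth A \<longleftrightarrow> smooth A \<and> (\<forall>\<phi> k. A (\<phi> + (2 * pi) *\<^sub>R ivec k) = A \<phi>)"

text \<open>A smooth embedding of the torus: an injective immersion that is a homeomorphism onto its
  image. The open subsets of the torus correspond to the open subsets of \<open>\<real>\<^sup>m\<close> that are
  invariant under translation by \<open>2\<pi>\<int>\<^sup>m\<close>, so the last conjunct says that the induced map on
  the torus is open onto its image.\<close>

definition torus_embedding :: "(real^'m::finite \<Rightarrow> real^'M::finite) \<Rightarrow> bool" where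
  "torus_embedding e \<longleftrightarrow> torus_smooth e \<and>
     (\<forall>\<phi>. inj (frechet_derivative e (at \<phi>))) \<and>
     (\<forall>\<phi> \<psi>. e \<phi> = e \<psi> \<longrightarrow> (\<exists>k. \<psi> = \<phi> + (2 * pi) *\<^sub>R ivec k)) \<and>
     (\<forall>U. open U \<and> (\<forall>\<phi>\<in>U. \<forall>k. \<phi> + (2 * pi) *\<^sub>R ivec k \<in> U) \<longrightarrow>
        openin (top_of_set (range e)) (e ` U))"

definition dderiv :: "real^'m::finite \<Rightarrow> (real^'m \<Rightarrow> 'b::euclidean_space) \<Rightarrow> real^'m \<Rightarrow> 'b" where
  "dderiv \<omega> A \<phi> = frechet_derivative A (at \<phi>) \<omega>"

definition invariant_torus ::
  "(real^'M::finite \<Rightarrow> real^'M) \<Rightarrow> real^'m::finite \<Rightarrow> (real^'m \<Rightarrow> real^'M) \<Rightarrow> bool" where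
  "invariant_torus F0 \<omega> e0 \<longleftrightarrow> torus_embedding e0 \<and> (\<forall>\<phi>. dderiv \<omega> e0 \<phi> = F0 (e0 \<phi>))"

text \<open>Linear maps are given by matrices. A solution curve on the torus is represented by a lift
  to \<open>\<real>\<^sup>m\<close>; as the linear flow is complete, curves defined for all times suffice.\<close>

definition reducible_by ::
  "(real^'M::finite \<Rightarrow> real^'M) \<Rightarrow> real^'m::finite \<Rightarrow> (real^'m \<Rightarrow> real^'M) \<Rightarrow>
   (real^'m \<Rightarrow> real^'n::finite^'M) \<Rightarrow> real^'n^'n \<Rightarrow> bool" where
  "reducible_by F0 \<omega> e0 N L \<longleftrightarrow> torus_smooth N \<and>
     (\<forall>\<phi>. {x + y | x y. x \<in> range (frechet_derivative e0 (at \<phi>)) \<and> y \<in> range ((*v) (N \<phi>))} = UNIV \<and>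
          range (frechet_derivative e0 (at \<phi>)) \<inter> range ((*v) (N \<phi>)) = {0}) \<and>
     (\<forall>\<phi> u. (\<forall>t. (\<phi> has_vector_derivative \<omega>) (at t)) \<and>
            (\<forall>t. (u has_vector_derivative L *v u t) (at t)) \<longrightarrow>
        (\<forall>t. ((\<lambda>s. (e0 (\<phi> s), N (\<phi> s) *v u s)) has_vector_derivative
               (F0 (e0 (\<phi> t)), frechet_derivative F0 (at (e0 (\<phi> t))) (N (\<phi> t) *v u t))) (at t)))"

definition cmat :: "real^'n::finite^'k::finite \<Rightarrow> complex^'n^'k" where
  "cmat A = map_matrix complex_of_real A"

definition hyperbolic_matrix :: "real^'n::finite^'n \<Rightarrow> bool" where
  "hyperbolic_matrix L \<longleftrightarrow>
     (\<forall>(z::complex) v. v \<noteq> 0 \<and> cmat L *v v = z *s v \<longrightarrow> Re z \<noteq> 0)"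

definition conj_op ::
  "(real^'M::finite \<Rightarrow> real^'M) \<Rightarrow> (real^'m::finite \<Rightarrow> real^'M) \<Rightarrow> real^'m \<Rightarrow>
   (real^'m \<Rightarrow> real^'M) \<Rightarrow> (real^'m \<Rightarrow> real^'m) \<Rightarrow> real^'m \<Rightarrow> real^'M" where
  "conj_op F0 e0 \<omega> e f \<phi> =
     dderiv \<omega> e \<phi> - frechet_derivative F0 (at (e0 \<phi>)) (e \<phi>) + frechet_derivative e0 (at \<phi>) (f \<phi>)"

definition iter_deriv :: "nat \<Rightarrow> (real \<Rightarrow> 'b::real_normed_vector) \<Rightarrow> real \<Rightarrow> 'b" where
  "iter_deriv j = (\<lambda>c t. vector_derivative c (at t)) ^^ j"

text \<open>The zeroth order of \<open>f\<close> is the constant \<open>\<omega>\<close>, so the value \<open>f 0\<close> is never used.\<close>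

definition G_rhs ::
  "(nat \<Rightarrow> real^'M::finite \<Rightarrow> real^'M) \<Rightarrow> real^'m::finite \<Rightarrow> (nat \<Rightarrow> real^'m \<Rightarrow> real^'M) \<Rightarrow>
   (nat \<Rightarrow> real^'m \<Rightarrow> real^'m) \<Rightarrow> nat \<Rightarrow> real^'m \<Rightarrow> real^'M" where
  "G_rhs F \<omega> e f j \<phi> = (1 / fact j) *\<^sub>R
     iter_deriv j (\<lambda>\<epsilon>.
       (\<Sum>i\<le>j. \<epsilon> ^ i *\<^sub>R F i (\<Sum>l<j. \<epsilon> ^ l *\<^sub>R e l \<phi>))
       - frechet_derivative (\<lambda>\<psi>. \<Sum>l<j. \<epsilon> ^ l *\<^sub>R e l \<psi>) (at \<phi>)
           (\<omega> + (\<Sum>l=1..<j. \<epsilon> ^ l *\<^sub>R f l \<phi>))) 0"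

definition iter_solution ::
  "(nat \<Rightarrow> real^'M::finite \<Rightarrow> real^'M) \<Rightarrow> real^'m::finite \<Rightarrow> (nat \<Rightarrow> real^'m \<Rightarrow> real^'M) \<Rightarrow>
   (nat \<Rightarrow> real^'m \<Rightarrow> real^'m) \<Rightarrow> nat \<Rightarrow> bool" where
  "iter_solution F \<omega> e f j \<longleftrightarrow> torus_smooth (e j) \<and> torus_smooth (f j) \<and>
     (\<forall>\<phi>. conj_op (F 0) (e 0) \<omega> (e j) (f j) \<phi> = G_rhs F \<omega> e f j \<phi>)"

text \<open>\<open>e = e\<^sub>0' g + N h\<close> with smooth tangential component \<open>g\<close> and normal component \<open>h\<close>.\<close>

definition splits ::
  "(real^'m::finite \<Rightarrow> real^'M::finite) \<Rightarrow> (real^'m \<Rightarrow> real^'n::finite^'M) \<Rightarrow>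
   (real^'m \<Rightarrow> real^'M) \<Rightarrow> (real^'m \<Rightarrow> real^'m) \<Rightarrow> (real^'m \<Rightarrow> real^'n) \<Rightarrow> bool" where
  "splits e0 N e g h \<longleftrightarrow> torus_smooth g \<and> torus_smooth h \<and>
     (\<forall>\<phi>. e \<phi> = frechet_derivative e0 (at \<phi>) (g \<phi>) + N \<phi> *v h \<phi>)"

definition proj_along ::
  "(real^'m::finite \<Rightarrow> real^'M::finite) \<Rightarrow> (real^'m \<Rightarrow> real^'n::finite^'M) \<Rightarrow> real^'m \<Rightarrow> real^'M^'M" where
  "proj_along e0 N \<phi> = (THE P. P ** P = P \<and>
     P ** jacobian e0 (at \<phi>) = jacobian e0 (at \<phi>) \<and> P ** N \<phi> = 0)"

definition pinv :: "real^'k::finite^'l::finite \<Rightarrow> real^'l^'k" where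
  "pinv A = matrix_inv (transpose A ** A) ** transpose A"

definition U_rhs ::
  "(nat \<Rightarrow> real^'M::finite \<Rightarrow> real^'M) \<Rightarrow> real^'m::finite \<Rightarrow> (real^'m \<Rightarrow> real^'n::finite^'M) \<Rightarrow>
   (nat \<Rightarrow> real^'m \<Rightarrow> real^'M) \<Rightarrow> (nat \<Rightarrow> real^'m \<Rightarrow> real^'m) \<Rightarrow> nat \<Rightarrow> real^'m \<Rightarrow> real^'m" where
  "U_rhs F \<omega> N e f j \<phi> =
     pinv (jacobian (e 0) (at \<phi>)) *v (proj_along (e 0) N \<phi> *v G_rhs F \<omega> e f j \<phi>)"

definition V_rhs ::
  "(nat \<Rightarrow> real^'M::finite \<Rightarrow> real^'M) \<Rightarrow> real^'m::finite \<Rightarrow> (real^'m \<Rightarrow> real^'n::finite^'M) \<Rightarrow>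
   (nat \<Rightarrow> real^'m \<Rightarrow> real^'M) \<Rightarrow> (nat \<Rightarrow> real^'m \<Rightarrow> real^'m) \<Rightarrow> nat \<Rightarrow> real^'m \<Rightarrow> real^'n" where
  "V_rhs F \<omega> N e f j \<phi> =
     pinv (N \<phi>) *v ((mat 1 - proj_along (e 0) N \<phi>) *v G_rhs F \<omega> e f j \<phi>)"

text \<open>\<open>A\<^sub>k = (2\<pi>)\<^sup>-\<^sup>m \<integral> A(\<phi>) exp (-i\<langle>k,\<phi>\<rangle>) d\<phi>\<close> over one period cell, computed
  componentwise.\<close>

definition fcoeff :: "(real^'m::finite \<Rightarrow> real^'d::finite) \<Rightarrow> int^'m \<Rightarrow> complex^'d" where
  "fcoeff A k = (\<chi> i. of_real (1 / (2 * pi) ^ CARD('m)) *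
     integral (cbox 0 (\<chi> l. 2 * pi)) (\<lambda>\<phi>. complex_of_real (A \<phi> $ i) * cis (- (ivec k \<bullet> \<phi>))))"

definition normal_form ::
  "real^'m::finite \<Rightarrow> enat \<Rightarrow> (real^'m \<Rightarrow> real^'m) \<Rightarrow> bool" where
  "normal_form \<omega> K f \<longleftrightarrow>
     (\<forall>k. \<omega> \<bullet> ivec k \<noteq> 0 \<and> ereal (norm (ivec k)) \<le> ereal_of_enat K \<longrightarrow> fcoeff f k = 0)"

definition resolvent_mat :: "real^'m::finite \<Rightarrow> real^'n::finite^'n \<Rightarrow> int^'m \<Rightarrow> complex^'n^'n" where
  "resolvent_mat \<omega> L k = mat (\<i> * complex_of_real (\<omega> \<bullet> ivec k)) - cmat L"

end

theory Submission
  imports Defs "HOL-Computational_Algebra.Fundamental_Theorem_Algebra"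
begin

text \<open>Differentiating \<open>\<partial>\<^sub>\<omega> e\<^sub>0 = F\<^sub>0 \<circ> e\<^sub>0\<close> gives \<open>\<partial>\<^sub>\<omega> e\<^sub>0' = (F\<^sub>0' \<circ> e\<^sub>0) e\<^sub>0'\<close>, and reducibility gives
  \<open>\<partial>\<^sub>\<omega> N + N L = (F\<^sub>0' \<circ> e\<^sub>0) N\<close>. Hence, for \<open>e\<^sub>j = e\<^sub>0' g + N h\<close>, the left-hand side of the iterative
  equation is \<open>e\<^sub>0' (\<partial>\<^sub>\<omega> g + f\<^sub>j) + N (\<partial>\<^sub>\<omega> h - L h)\<close>, and the equation splits into
  \<open>\<partial>\<^sub>\<omega> g + f\<^sub>j = U\<^sub>j\<close> and \<open>\<partial>\<^sub>\<omega> h - L h = V\<^sub>j\<close>. The first is solved by \<open>f\<^sub>j\<close> for any \<open>g\<close>; choosing \<open>g\<close>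
  to be a trigonometric polynomial removes finitely many nonresonant coefficients of \<open>f\<^sub>j\<close>.
  Smooth solvability of the second is obtained without summing Fourier series: for an eigenvalue
  \<open>l\<close> with \<open>Re l > 0\<close> the scalar equation \<open>(\<partial>\<^sub>\<omega> - l) u = v\<close> is solved by
  \<open>-\<integral>\<^sub>0\<^sup>\<infinity> e\<^bsup>-lt\<^esup> v(\<phi> + t\<omega>) dt\<close> (with time reversed if \<open>Re l < 0\<close>), and the vector equation reduces to scalar ones through a polynomial
  annihilating \<open>L\<close>. Uniqueness is uniqueness of Fourier coefficients.\<close>

section \<open>Smooth maps on Euclidean spaces\<close>

text \<open>Building h from its series would call for decay estimates on the coefficients and for
  termwise differentiation. Integration along the flow asks only that the right-hand side be
  bounded, since hyperbolicity supplies exponential damping, and differentiating the integral merely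
  replaces the right-hand side by its derivative. Fourier coefficients then serve as a translation:
  two smooth torus maps agree iff all their coefficients agree, so the pointwise equation is
  equivalent to the explicit formulas and determines h. The finiteness of K in (iii) avoids small
  divisors: only finitely many numbers <omega,k> are inverted, so no Diophantine condition on omega
  enters and the chosen g is a finite sum.\<close>

lemma Ck_SucI:
  assumes "\<And>x. (f has_derivative f' x) (at x)" "\<And>v. Ck k (\<lambda>x. f' x v)"
  shows "Ck (Suc k) f"
proof -
  have "frechet_derivative f (at x) = f' x" for x
    using assms(1) frechet_derivative_at by metis
  moreover have "f differentiable (at x)" for x
    using assms(1) by (auto simp: differentiable_def)
  ultimately show ?thesis using assms(2) by simp
qed

lemma Ck_Suc_has_derivative:
  "Ck (Suc k) f \<Longrightarrow> (f has_derivative frechet_derivative f (at x)) (at x)"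
  by (simp add: frechet_derivative_works[symmetric])

lemma Ck_Suc_derivative: "Ck (Suc k) f \<Longrightarrow> Ck k (\<lambda>x. frechet_derivative f (at x) v)"
  by simp

lemma Ck_Suc_imp: "Ck (Suc k) f \<Longrightarrow> Ck k f"
proof (induction k arbitrary: f)
  case 0
  then show ?case
    by (auto intro!: continuous_at_imp_continuous_on differentiable_imp_continuous_within)
next
  case (Suc k)
  then show ?case by (metis Ck.simps(2))
qed

lemma Ck_const: "Ck k (\<lambda>x. c)"
proof (induction k arbitrary: c)
  case (Suc k)
  show ?case by (rule Ck_SucI[where f'="\<lambda>_ _. 0"]) (auto intro: Suc)
qed auto

lemma Ck_add: "Ck k f \<Longrightarrow> Ck k g \<Longrightarrow> Ck k (\<lambda>x. f x + g x)"
proof (induction k arbitrary: f g)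
  case (Suc k)
  show ?case
    by (rule Ck_SucI, rule has_derivative_add)
      (auto intro!: Ck_Suc_has_derivative Suc.IH Suc.prems Ck_Suc_derivative simp del: Ck.simps)
qed (auto intro!: continuous_on_add)

lemma Ck_bounded_linear:
  assumes "bounded_linear T" shows "Ck k f \<Longrightarrow> Ck k (\<lambda>x. T (f x))"
proof (induction k arbitrary: f)
  case 0
  then show ?case using bounded_linear.continuous_on[OF assms] by auto
next
  case (Suc k)
  show ?case
    by (rule Ck_SucI, rule bounded_linear.has_derivative[OF assms])
      (auto intro!: Ck_Suc_has_derivative Suc.IH Suc.prems Ck_Suc_derivative simp del: Ck.simps)
qed

text \<open>Covers scalar multiplication, products and matrix-vector products at once: by the
  product rule a directional derivative is a sum of two terms of the same bilinear shape, each with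
  one argument differentiated.\<close>

lemma Ck_bounded_bilinear:
  assumes "bounded_bilinear B" shows "Ck k f \<Longrightarrow> Ck k g \<Longrightarrow> Ck k (\<lambda>x. B (f x) (g x))"
proof (induction k arbitrary: f g)
  case 0
  then show ?case using bounded_bilinear.continuous_on[OF assms] by auto
next
  case (Suc k)
  note f = Suc.prems(1) and g = Suc.prems(2)
  show ?case
  proof (rule Ck_SucI)
    show "((\<lambda>x. B (f x) (g x)) has_derivative
        (\<lambda>v. B (f x) (frechet_derivative g (at x) v) + B (frechet_derivative f (at x) v) (g x))) (at x)" for x
      by (rule bounded_bilinear.FDERIV[OF assms Ck_Suc_has_derivative[OF f] Ck_Suc_has_derivative[OF g]])
    show "Ck k (\<lambda>x. B (f x) (frechet_derivative g (at x) v) + B (frechet_derivative f (at x) v) (g x))" for v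
      by (rule Ck_add[OF Suc.IH[OF Ck_Suc_imp[OF f] Ck_Suc_derivative[OF g]]
          Suc.IH[OF Ck_Suc_derivative[OF f] Ck_Suc_imp[OF g]]])
  qed
qed

lemma Ck_sum: "(\<And>i. i \<in> I \<Longrightarrow> Ck k (f i)) \<Longrightarrow> Ck k (\<lambda>x. \<Sum>i\<in>I. f i x)"
  by (induction I rule: infinite_finite_induct) (auto intro: Ck_const Ck_add)

lemma linear_eq_Basis_sum:
  fixes g :: "'a::euclidean_space \<Rightarrow> 'b::real_vector"
  assumes "linear g" shows "g w = (\<Sum>b\<in>Basis. (w \<bullet> b) *\<^sub>R g b)"
proof -
  have "g w = g (\<Sum>b\<in>Basis. (w \<bullet> b) *\<^sub>R b)"
    by (simp add: euclidean_representation)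
  then show ?thesis
    by (simp only: linear_sum[OF assms] linear_scale[OF assms])
qed

text \<open>\<open>Ck\<close> controls a derivative only in a direction that does not vary with the
  point, whereas the chain rule evaluates the derivative of \<open>g\<close> in the moving direction
  \<open>?f' x v\<close>. Expanding that direction in the basis leaves compositions of
  \<open>f\<close> with derivatives of \<open>g\<close> in fixed directions, to which the induction
  hypothesis applies.\<close>

lemma Ck_compose:
  fixes f :: "'a::euclidean_space \<Rightarrow> 'b::euclidean_space" and g :: "'b \<Rightarrow> 'c::euclidean_space"
  shows "Ck k f \<Longrightarrow> Ck k g \<Longrightarrow> Ck k (\<lambda>x. g (f x))"
proof (induction k arbitrary: f g)
  case 0
  then show ?case by (auto intro: continuous_on_compose2)
next
  case (Suc k)
  let ?g' = "\<lambda>x. frechet_derivative g (at x)" and ?f' = "\<lambda>x. frechet_derivative f (at x)"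
  have lin: "linear (?g' y)" for y
    using Ck_Suc_has_derivative[OF Suc.prems(2)] by (blast dest: has_derivative_linear)
  have exp: "?g' y w = (\<Sum>b\<in>Basis. (w \<bullet> b) *\<^sub>R ?g' y b)" for y w
    by (rule linear_eq_Basis_sum[OF lin])
  have "((\<lambda>x. g (f x)) has_derivative (\<lambda>v. ?g' (f x) (?f' x v))) (at x)" for x
    using diff_chain_at[OF Ck_Suc_has_derivative[OF Suc.prems(1)] Ck_Suc_has_derivative[OF Suc.prems(2)]]
    by (simp add: o_def)
  moreover have "Ck k (\<lambda>x. \<Sum>b\<in>Basis. (?f' x v \<bullet> b) *\<^sub>R ?g' (f x) b)" for v
  proof (rule Ck_sum, rule Ck_bounded_bilinear[OF bounded_bilinear_scaleR])
    fix b
    show "Ck k (\<lambda>x. ?f' x v \<bullet> b)"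
      by (rule Ck_bounded_linear[OF bounded_linear_inner_left Ck_Suc_derivative[OF Suc.prems(1)]])
    show "Ck k (\<lambda>x. ?g' (f x) b)"
      by (rule Suc.IH[OF Ck_Suc_imp[OF Suc.prems(1)] Ck_Suc_derivative[OF Suc.prems(2)]])
  qed
  then have "Ck k (\<lambda>x. ?g' (f x) (?f' x v))" for v
    by (subst exp)
  ultimately show ?case
    by (rule Ck_SucI)
qed

lemma Ck_inverse:
  fixes f :: "'a::euclidean_space \<Rightarrow> real"
  assumes "\<And>x. f x \<noteq> 0"
  shows "Ck k f \<Longrightarrow> Ck k (\<lambda>x. inverse (f x))"
proof (induction k)
  case 0
  then show ?case using assms by (auto intro!: continuous_on_inverse)
next
  case (Suc k)
  have "((\<lambda>x. inverse (f x)) has_derivative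
      (\<lambda>v. - (inverse (f x) * frechet_derivative f (at x) v * inverse (f x)))) (at x)" for x
    using Deriv.has_derivative_inverse[where f=f and x=x, OF assms Ck_Suc_has_derivative[OF Suc.prems]] .
  moreover have "Ck k (\<lambda>x. - (inverse (f x) * frechet_derivative f (at x) v * inverse (f x)))" for v
    by (intro Ck_bounded_linear[OF bounded_linear_minus[OF bounded_linear_ident]]
        Ck_bounded_bilinear[OF bounded_bilinear_mult] Suc.IH[OF Ck_Suc_imp[OF Suc.prems]]
        Ck_Suc_derivative[OF Suc.prems])
  ultimately show ?case
    by (rule Ck_SucI)
qed

lemma smooth_has_derivative:
  "smooth f \<Longrightarrow> (f has_derivative frechet_derivative f (at x)) (at x)"
  unfolding smooth_def by (blast intro: Ck_Suc_has_derivative)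

lemma smooth_linear: "smooth f \<Longrightarrow> linear (frechet_derivative f (at x))"
  by (blast dest: smooth_has_derivative has_derivative_linear)

lemma smooth_continuous_on: "smooth f \<Longrightarrow> continuous_on S f"
  unfolding smooth_def by (metis Ck.simps(1) continuous_on_subset subset_UNIV)

lemma smooth_frechet_derivative: "smooth f \<Longrightarrow> smooth (\<lambda>x. frechet_derivative f (at x) v)"
  unfolding smooth_def by (blast intro: Ck_Suc_derivative)

lemma smooth_const: "smooth (\<lambda>x. c)"
  by (simp add: smooth_def Ck_const)

lemma smooth_add: "smooth f \<Longrightarrow> smooth g \<Longrightarrow> smooth (\<lambda>x. f x + g x)"
  by (simp add: smooth_def Ck_add)

lemma smooth_bounded_linear: "bounded_linear T \<Longrightarrow> smooth f \<Longrightarrow> smooth (\<lambda>x. T (f x))"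
  by (simp add: smooth_def Ck_bounded_linear)

lemma smooth_bounded_bilinear:
  "bounded_bilinear B \<Longrightarrow> smooth f \<Longrightarrow> smooth g \<Longrightarrow> smooth (\<lambda>x. B (f x) (g x))"
  by (simp add: smooth_def Ck_bounded_bilinear)

lemma smooth_sum: "(\<And>i. i \<in> I \<Longrightarrow> smooth (f i)) \<Longrightarrow> smooth (\<lambda>x. \<Sum>i\<in>I. f i x)"
  by (simp add: smooth_def Ck_sum)

lemma smooth_compose: "smooth g \<Longrightarrow> smooth f \<Longrightarrow> smooth (\<lambda>x. g (f x))"
  by (simp add: smooth_def Ck_compose)

lemma smooth_inverse:
  fixes f :: "'a::euclidean_space \<Rightarrow> real"
  shows "(\<And>x. f x \<noteq> 0) \<Longrightarrow> smooth f \<Longrightarrow> smooth (\<lambda>x. inverse (f x))"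
  by (simp add: smooth_def Ck_inverse)

lemma smooth_ident: "smooth (\<lambda>x. x)"
  unfolding smooth_def
proof
  fix k show "Ck k (\<lambda>x. x)"
    by (cases k)
      (auto intro: continuous_on_id Ck_SucI[where f'="\<lambda>_ v. v"] Ck_const simp del: Ck.simps(2))
qed

lemma smooth_diff: "smooth f \<Longrightarrow> smooth g \<Longrightarrow> smooth (\<lambda>x. f x - g x)"
  using smooth_add[OF _ smooth_bounded_linear[OF bounded_linear_minus[OF bounded_linear_ident]], of f g]
  by simp

lemmas smooth_scaleR = smooth_bounded_bilinear[OF bounded_bilinear_scaleR]
lemmas smooth_mult = smooth_bounded_bilinear[OF bounded_bilinear_mult]

lemma smooth_prod:
  fixes f :: "'i \<Rightarrow> 'a::euclidean_space \<Rightarrow> real"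
  shows "(\<And>i. i \<in> I \<Longrightarrow> smooth (f i)) \<Longrightarrow> smooth (\<lambda>x. \<Prod>i\<in>I. f i x)"
  by (induction I rule: infinite_finite_induct) (auto intro: smooth_const smooth_mult)

lemma smooth_power:
  fixes f :: "'a::euclidean_space \<Rightarrow> real"
  shows "smooth f \<Longrightarrow> smooth (\<lambda>x. f x ^ n)"
  by (induction n) (auto intro: smooth_const smooth_mult)

lemma smooth_frechet_derivative_apply:
  assumes "smooth f" "smooth x" "smooth w"
  shows "smooth (\<lambda>p. frechet_derivative f (at (x p)) (w p))"
proof -
  have "frechet_derivative f (at (x p)) (w p) =
      (\<Sum>b\<in>Basis. (w p \<bullet> b) *\<^sub>R frechet_derivative f (at (x p)) b)" for p
    by (rule linear_eq_Basis_sum[OF smooth_linear[OF assms(1)]])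
  moreover have "smooth (\<lambda>p. \<Sum>b\<in>Basis. (w p \<bullet> b) *\<^sub>R frechet_derivative f (at (x p)) b)"
    by (intro smooth_sum smooth_scaleR smooth_bounded_linear[OF bounded_linear_inner_left]
        smooth_compose[OF _ assms(2)] smooth_frechet_derivative assms)
  ultimately show ?thesis by simp
qed

lemma smooth_cart:
  fixes f :: "'a::euclidean_space \<Rightarrow> 'b::euclidean_space^'n"
  assumes "\<And>i. smooth (\<lambda>x. f x $ i)"
  shows "smooth f"
proof -
  have "bounded_linear (\<lambda>y::'b. axis i y :: 'b^'n)" for i
    by (intro linear_conv_bounded_linear[THEN iffD1] linearI) (auto simp: axis_def vec_eq_iff)
  then have "smooth (\<lambda>x. \<Sum>i\<in>UNIV. axis i (f x $ i))"
    by (intro smooth_sum) (rule smooth_bounded_linear[OF _ assms])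
  moreover have "(\<Sum>i\<in>UNIV. axis i (f x $ i)) = f x" for x
    by (simp add: vec_eq_iff axis_def if_distrib cong: if_cong)
  ultimately show ?thesis by simp
qed

section \<open>Differentiation under the integral sign and symmetry of second derivatives\<close>

lemma frechet_derivative_eqI:
  assumes "(f has_derivative f') (at x)" shows "frechet_derivative f (at x) = f'"
  using frechet_derivative_at[OF assms] by simp

text \<open>\<open>leibniz_rule\<close> wants a derivative that is continuous as a map into bounded
  linear operators, whereas \<open>Ck\<close> supplies continuity in each fixed direction. In finite
  dimension the two agree.\<close>

lemma parametric_integral_has_derivative:
  fixes f :: "'a::euclidean_space \<Rightarrow> 'b::euclidean_space \<Rightarrow> 'c::euclidean_space"
  assumes der: "\<And>x t. t \<in> cbox a b \<Longrightarrow> ((\<lambda>x. f x t) has_derivative f' x t) (at x)"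
    and cont: "continuous_on (UNIV \<times> cbox a b) (\<lambda>(x,t). f x t)"
    and cont': "\<And>v. continuous_on (UNIV \<times> cbox a b) (\<lambda>(x,t). f' x t v)"
  shows "((\<lambda>x. integral (cbox a b) (f x)) has_derivative
      (\<lambda>v. integral (cbox a b) (\<lambda>t. f' x t v))) (at x)"
proof -
  define D where "D = (\<lambda>x t. Blinfun (f' x t))"
  have D: "blinfun_apply (D x t) = f' x t" if "t \<in> cbox a b" for x t
    using has_derivative_bounded_linear[OF der[OF that]] by (simp add: D_def bounded_linear_Blinfun_apply)
  have contD: "continuous_on (UNIV \<times> cbox a b) (\<lambda>(x,t). D x t)"
  proof (rule continuous_on_blinfun_componentwise)
    fix i :: 'a
    show "continuous_on (UNIV \<times> cbox a b) (\<lambda>p. blinfun_apply (case p of (x,t) \<Rightarrow> D x t) i)"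
      using cont'[of i] by (rule continuous_on_eq) (auto simp: D)
  qed
  have contDx: "continuous_on (cbox a b) (D x)"
    using continuous_on_compose2[OF contD, of "cbox a b" "\<lambda>t. (x,t)"]
    by (simp add: continuous_on_Pair continuous_on_id continuous_on_const image_subset_iff)
  have "((\<lambda>x. integral (cbox a b) (f x)) has_derivative blinfun_apply (integral (cbox a b) (D x))) (at x)"
  proof (rule leibniz_rule[where U=UNIV, simplified])
    show "((\<lambda>x. f x t) has_derivative blinfun_apply (D x t)) (at x)" if "t \<in> cbox a b" for x t
      using der[OF that] D[OF that] by simp
    show "f x integrable_on cbox a b" for x
      using continuous_on_compose2[OF cont, of "cbox a b" "\<lambda>t. (x,t)"]
      by (intro integrable_continuous) (simp add: continuous_on_Pair continuous_on_id continuous_on_const image_subset_iff)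
  qed (use contD in auto)
  moreover have "blinfun_apply (integral (cbox a b) (D x)) = (\<lambda>v. integral (cbox a b) (\<lambda>t. f' x t v))"
  proof
    fix v
    have "blinfun_apply (integral (cbox a b) (D x)) v = integral (cbox a b) (\<lambda>t. blinfun_apply (D x t) v)"
      by (rule blinfun_apply_integral) (rule integrable_continuous[OF contDx])
    also have "\<dots> = integral (cbox a b) (\<lambda>t. f' x t v)"
      by (rule integral_cong) (simp add: D)
    finally show "blinfun_apply (integral (cbox a b) (D x)) v = \<dots>" .
  qed
  ultimately show ?thesis by simp
qed

lemma continuous_on_parametric_integral:
  fixes f :: "'a::euclidean_space \<Rightarrow> 'b::euclidean_space \<Rightarrow> 'c::euclidean_space"
  assumes "continuous_on (UNIV \<times> cbox a b) (\<lambda>(x,t). f x t)"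
  shows "continuous_on UNIV (\<lambda>x. integral (cbox a b) (f x))"
  using integral_continuous_on_param[OF assms] by simp

lemma has_vector_derivative_along_line:
  assumes "(f has_derivative f') (at (x + t *\<^sub>R v))"
  shows "((\<lambda>s. f (x + s *\<^sub>R v)) has_vector_derivative f' v) (at t)"
proof -
  have "((\<lambda>s. x + s *\<^sub>R v) has_vector_derivative v) (at t)"
    by (auto intro!: derivative_eq_intros)
  then have "(f \<circ> (\<lambda>s. x + s *\<^sub>R v) has_derivative f' \<circ> (\<lambda>s. s *\<^sub>R v)) (at t)"
    unfolding has_vector_derivative_def using assms by (rule diff_chain_at)
  moreover have "f' \<circ> (\<lambda>s. s *\<^sub>R v) = (\<lambda>s. s *\<^sub>R f' v)"
    using has_derivative_linear[OF assms] by (auto simp: linear_scale o_def)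
  ultimately show ?thesis
    by (simp add: has_vector_derivative_def o_def)
qed

text \<open>Write f(y + t v) as f(y) plus the integral of the v-derivative along the segment,
  differentiate in y along u under the integral, and compare the derivatives of both sides in t at t
  = 0.\<close>

lemma frechet_derivative_commute:
  fixes f :: "'a::euclidean_space \<Rightarrow> 'b::euclidean_space"
  assumes f: "smooth f"
  shows "frechet_derivative (\<lambda>x. frechet_derivative f (at x) u) (at x) v =
    frechet_derivative (\<lambda>x. frechet_derivative f (at x) v) (at x) u"
proof -
  define D where "D u x = frechet_derivative f (at x) u" for u x
  define DD where "DD u v x = frechet_derivative (D u) (at x) v" for u v x
  have D: "smooth (D u)" for u
    unfolding D_def by (rule smooth_frechet_derivative[OF f])
  have DD: "smooth (DD u v)" for u v
    unfolding DD_def by (rule smooth_frechet_derivative[OF D])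
  have line: "continuous_on S (\<lambda>\<tau>. x + \<tau> *\<^sub>R v)" for S :: "real set" and x v :: 'a
    by (intro continuous_intros)
  have comp: "continuous_on (UNIV \<times> cbox 0 t) (\<lambda>(y,\<tau>). h (y + \<tau> *\<^sub>R v))"
    if "smooth h" for h :: "'a \<Rightarrow> 'b" and t :: real
    unfolding split_beta
    by (rule continuous_on_compose2[OF smooth_continuous_on[OF that, of UNIV]]) (auto intro!: continuous_intros)
  have increment: "f (y + t *\<^sub>R v) = f y + integral (cbox 0 t) (\<lambda>\<tau>. D v (y + \<tau> *\<^sub>R v))"
    if "0 \<le> t" for t y
  proof -
    have "((\<lambda>\<tau>. D v (y + \<tau> *\<^sub>R v)) has_integral (f (y + t *\<^sub>R v) - f (y + 0 *\<^sub>R v))) {0..t}"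
    proof (rule fundamental_theorem_of_calculus[OF that], rule has_vector_derivative_at_within)
      show "((\<lambda>\<tau>. f (y + \<tau> *\<^sub>R v)) has_vector_derivative D v (y + \<tau> *\<^sub>R v)) (at \<tau>)" for \<tau>
        unfolding D_def by (rule has_vector_derivative_along_line[OF smooth_has_derivative[OF f]])
    qed
    then have "integral {0..t} (\<lambda>\<tau>. D v (y + \<tau> *\<^sub>R v)) = f (y + t *\<^sub>R v) - f (y + 0 *\<^sub>R v)"
      by (rule integral_unique)
    then show ?thesis by simp
  qed
  have increment': "D u (x + t *\<^sub>R v) = D u x + integral {0..t} (\<lambda>\<tau>. DD v u (x + \<tau> *\<^sub>R v))"
    if t: "0 \<le> t" for t
  proof -
    have "((\<lambda>y. f (y + t *\<^sub>R v)) has_derivative (\<lambda>w. D w (x + t *\<^sub>R v))) (at x)"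
      unfolding D_def
      using has_derivative_compose[OF has_derivative_add_const[OF has_derivative_ident]
          smooth_has_derivative[OF f]] by simp
    moreover have "((\<lambda>y. integral (cbox 0 t) (\<lambda>\<tau>. D v (y + \<tau> *\<^sub>R v))) has_derivative
        (\<lambda>w. integral (cbox 0 t) (\<lambda>\<tau>. DD v w (x + \<tau> *\<^sub>R v)))) (at x)"
    proof (rule parametric_integral_has_derivative[where f'="\<lambda>y \<tau> w. DD v w (y + \<tau> *\<^sub>R v)"])
      show "((\<lambda>y. D v (y + \<tau> *\<^sub>R v)) has_derivative (\<lambda>w. DD v w (y + \<tau> *\<^sub>R v))) (at y)" for y \<tau>
        unfolding DD_def
        using has_derivative_compose[OF has_derivative_add_const[OF has_derivative_ident]
          smooth_has_derivative[OF D]] by simp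
    qed (use comp D DD in auto)
    then have "((\<lambda>y. f (y + t *\<^sub>R v)) has_derivative
        (\<lambda>w. D w x + integral (cbox 0 t) (\<lambda>\<tau>. DD v w (x + \<tau> *\<^sub>R v)))) (at x)"
      unfolding increment[OF t] using has_derivative_add[OF smooth_has_derivative[OF f]]
      by (simp add: D_def)
    ultimately have "(\<lambda>w. D w (x + t *\<^sub>R v)) =
        (\<lambda>w. D w x + integral (cbox 0 t) (\<lambda>\<tau>. DD v w (x + \<tau> *\<^sub>R v)))"
      by (rule has_derivative_unique)
    then show ?thesis by (metis interval_cbox)
  qed
  have cont: "continuous_on {0..1} (\<lambda>\<tau>. DD v u (x + \<tau> *\<^sub>R v))"
    by (rule continuous_on_compose2[OF smooth_continuous_on[OF DD, of UNIV] line]) simp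
  \<comment> \<open>The increment formula is available for nonnegative t only, so one-sided
    derivatives at 0 within [0,1] are compared; they are unique there.\<close>
  have "((\<lambda>t. D u x + integral {0..t} (\<lambda>\<tau>. DD v u (x + \<tau> *\<^sub>R v))) has_vector_derivative
      DD v u (x + 0 *\<^sub>R v)) (at 0 within {0..1})"
    using integral_has_vector_derivative[OF cont, of 0] by (auto intro!: derivative_eq_intros)
  then have "((\<lambda>t. D u (x + t *\<^sub>R v)) has_vector_derivative DD v u (x + 0 *\<^sub>R v)) (at 0 within {0..1})"
    by (rule has_vector_derivative_transform[rotated 2]) (auto simp: increment')
  moreover have "((\<lambda>t. D u (x + t *\<^sub>R v)) has_vector_derivative DD u v x) (at 0 within {0..1})"
    unfolding DD_def
    by (rule has_vector_derivative_at_within, rule has_vector_derivative_along_line)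
      (use smooth_has_derivative[OF D] in simp)
  ultimately have "DD v u (x + 0 *\<^sub>R v) = DD u v x"
    by (intro vector_derivative_unique_within_closed_interval[of 0 1 0]) auto
  then show ?thesis by (simp add: DD_def D_def[abs_def])
qed

section \<open>Smooth maps on the torus\<close>

lemma torus_smooth_smooth: "torus_smooth f \<Longrightarrow> smooth f"
  by (simp add: torus_smooth_def)

lemma torus_smooth_periodic: "torus_smooth f \<Longrightarrow> f (\<phi> + (2 * pi) *\<^sub>R ivec k) = f \<phi>"
  by (simp add: torus_smooth_def)

lemma torus_smooth_const: "torus_smooth (\<lambda>\<phi>. c)"
  by (simp add: torus_smooth_def smooth_const)

lemma torus_smooth_add: "torus_smooth f \<Longrightarrow> torus_smooth g \<Longrightarrow> torus_smooth (\<lambda>\<phi>. f \<phi> + g \<phi>)"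
  by (simp add: torus_smooth_def smooth_add)

lemma torus_smooth_diff: "torus_smooth f \<Longrightarrow> torus_smooth g \<Longrightarrow> torus_smooth (\<lambda>\<phi>. f \<phi> - g \<phi>)"
  by (simp add: torus_smooth_def smooth_diff)

lemma torus_smooth_sum:
  "(\<And>i. i \<in> I \<Longrightarrow> torus_smooth (f i)) \<Longrightarrow> torus_smooth (\<lambda>\<phi>. \<Sum>i\<in>I. f i \<phi>)"
  by (simp add: torus_smooth_def smooth_sum)

lemma torus_smooth_bounded_linear:
  "bounded_linear T \<Longrightarrow> torus_smooth f \<Longrightarrow> torus_smooth (\<lambda>\<phi>. T (f \<phi>))"
  by (simp add: torus_smooth_def smooth_bounded_linear)

lemma torus_smooth_bounded_bilinear:
  "bounded_bilinear B \<Longrightarrow> torus_smooth f \<Longrightarrow> torus_smooth g \<Longrightarrow> torus_smooth (\<lambda>\<phi>. B (f \<phi>) (g \<phi>))"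
  by (simp add: torus_smooth_def smooth_bounded_bilinear)

lemma torus_smooth_cart:
  fixes f :: "real^'m \<Rightarrow> 'b::euclidean_space^'n"
  assumes "\<And>i. torus_smooth (\<lambda>\<phi>. f \<phi> $ i)"
  shows "torus_smooth f"
  using assms by (auto simp: torus_smooth_def vec_eq_iff intro: smooth_cart)

lemmas torus_smooth_vec_nth = torus_smooth_bounded_linear[OF bounded_linear_vec_nth]

lemma torus_smooth_has_derivative:
  "torus_smooth f \<Longrightarrow> (f has_derivative frechet_derivative f (at x)) (at x)"
  by (simp add: torus_smooth_def smooth_has_derivative)

lemma frechet_derivative_periodic:
  assumes "torus_smooth f"
  shows "frechet_derivative f (at (\<phi> + (2 * pi) *\<^sub>R ivec k)) = frechet_derivative f (at \<phi>)"
proof (rule frechet_derivative_eqI)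
  let ?p = "(2 * pi) *\<^sub>R ivec k"
  have "((\<lambda>x. f (x - ?p)) has_derivative frechet_derivative f (at \<phi>)) (at (\<phi> + ?p))"
    using has_derivative_compose[of "\<lambda>x. x - ?p" "\<lambda>v. v" "\<phi> + ?p" UNIV f] torus_smooth_has_derivative[OF assms, of \<phi>]
    by (simp add: has_derivative_diff[OF has_derivative_ident has_derivative_const, simplified])
  moreover have "f (x - ?p) = f x" for x
    using torus_smooth_periodic[OF assms, of "x - ?p" k] by simp
  ultimately show "(f has_derivative frechet_derivative f (at \<phi>)) (at (\<phi> + ?p))"
    by simp
qed

lemma torus_smooth_frechet_derivative:
  assumes "torus_smooth f" shows "torus_smooth (\<lambda>\<phi>. frechet_derivative f (at \<phi>) v)"
  using assms frechet_derivative_periodic[OF assms]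
  by (simp add: torus_smooth_def smooth_frechet_derivative)

lemma torus_smooth_dderiv: "torus_smooth f \<Longrightarrow> torus_smooth (dderiv \<omega> f)"
  using torus_smooth_frechet_derivative[of f \<omega>] by (simp add: dderiv_def[abs_def])

lemma dderiv_eqI: "(f has_derivative f') (at \<phi>) \<Longrightarrow> dderiv \<omega> f \<phi> = f' \<omega>"
  by (simp add: dderiv_def frechet_derivative_eqI)

lemma dderiv_add:
  "torus_smooth f \<Longrightarrow> torus_smooth g \<Longrightarrow> dderiv \<omega> (\<lambda>\<phi>. f \<phi> + g \<phi>) \<phi> = dderiv \<omega> f \<phi> + dderiv \<omega> g \<phi>"
  by (subst dderiv_eqI[OF has_derivative_add]) (auto intro: torus_smooth_has_derivative simp: dderiv_def)

lemma dderiv_bounded_linear: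
  "bounded_linear T \<Longrightarrow> torus_smooth f \<Longrightarrow> dderiv \<omega> (\<lambda>\<phi>. T (f \<phi>)) \<phi> = T (dderiv \<omega> f \<phi>)"
  by (subst dderiv_eqI[OF bounded_linear.has_derivative])
    (auto intro: torus_smooth_has_derivative simp: dderiv_def)

lemma dderiv_bounded_bilinear:
  "bounded_bilinear B \<Longrightarrow> torus_smooth f \<Longrightarrow> torus_smooth g \<Longrightarrow>
    dderiv \<omega> (\<lambda>\<phi>. B (f \<phi>) (g \<phi>)) \<phi> = B (f \<phi>) (dderiv \<omega> g \<phi>) + B (dderiv \<omega> f \<phi>) (g \<phi>)"
  by (subst dderiv_eqI[OF bounded_bilinear.FDERIV])
    (auto intro: torus_smooth_has_derivative simp: dderiv_def)

lemma dderiv_uminus_direction: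
  "torus_smooth f \<Longrightarrow> dderiv (- \<omega>) f \<phi> = - dderiv \<omega> f \<phi>"
  by (simp add: dderiv_def linear_neg smooth_linear torus_smooth_smooth)

lemma dderiv_scaleR_direction:
  "torus_smooth f \<Longrightarrow> dderiv (c *\<^sub>R \<omega>) f \<phi> = c *\<^sub>R dderiv \<omega> f \<phi>"
  by (simp add: dderiv_def linear_scale smooth_linear torus_smooth_smooth)

lemma dderiv_commute:
  "torus_smooth f \<Longrightarrow> dderiv u (dderiv v f) \<phi> = dderiv v (dderiv u f) \<phi>"
  unfolding dderiv_def[abs_def]
  by (rule frechet_derivative_commute[OF torus_smooth_smooth])

lemma exists_translate_in_cube:
  obtains k where "\<phi> + (2 * pi) *\<^sub>R ivec k \<in> cbox 0 (\<chi> l. 2 * pi)"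
proof
  let ?k = "\<chi> i. - \<lfloor>\<phi> $ i / (2 * pi)\<rfloor>"
  have "0 \<le> frac (\<phi> $ i / (2 * pi)) * (2 * pi) \<and> frac (\<phi> $ i / (2 * pi)) * (2 * pi) \<le> 1 * (2 * pi)" for i
    by (intro conjI mult_right_mono mult_nonneg_nonneg) (auto simp: frac_lt_1 less_imp_le)
  moreover have "\<phi> $ i + 2 * pi * of_int (- \<lfloor>\<phi> $ i / (2 * pi)\<rfloor>) = frac (\<phi> $ i / (2 * pi)) * (2 * pi)" for i
    by (simp add: frac_def algebra_simps)
  ultimately show "\<phi> + (2 * pi) *\<^sub>R ivec ?k \<in> cbox 0 (\<chi> l. 2 * pi)"
    unfolding mem_box_cart by (simp add: ivec_def del: of_int_minus)
qed

lemma torus_smooth_bounded: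
  fixes f :: "real^'m \<Rightarrow> 'b::euclidean_space"
  assumes "torus_smooth f"
  obtains B where "\<And>\<phi>. norm (f \<phi>) \<le> B"
proof -
  have "compact (f ` cbox 0 (\<chi> l. 2 * pi))"
    by (intro compact_continuous_image smooth_continuous_on torus_smooth_smooth assms compact_cbox)
  then obtain B where B: "\<And>\<phi>. \<phi> \<in> cbox 0 (\<chi> l. 2 * pi) \<Longrightarrow> norm (f \<phi>) \<le> B"
    by (metis bounded_iff compact_imp_bounded imageI)
  have "norm (f \<phi>) \<le> B" for \<phi>
    using B torus_smooth_periodic[OF assms] exists_translate_in_cube by metis
  then show ?thesis by (rule that)
qed

section \<open>The scalar equation along the flow\<close>

text \<open>The exponent is normalised to real part 2: under s = exp(-t), exp(-2t) dt becomes s ds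
  up to orientation, a weight that forces the integrand to 0 at s = 0. Real part 1 would leave
  weight 1 and in general no limit there.\<close>

definition damped_flow_integral :: "real \<Rightarrow> real^'m::finite \<Rightarrow> (real^'m \<Rightarrow> complex) \<Rightarrow> real^'m \<Rightarrow> complex" where
  "damped_flow_integral \<beta> \<omega> v \<phi> =
     integral (cbox 0 1) (\<lambda>s. complex_of_real s * cis (\<beta> * ln s) * v (\<phi> - ln s *\<^sub>R \<omega>))"

text \<open>Only the points with s = 0 are delicate, because \<open>ln s\<close> diverges as s tends
  to 0. Compactness of the torus makes \<open>v\<close> bounded, so the factor s squeezes the
  integrand to 0.\<close>

lemma continuous_on_damped_integrand:
  fixes v :: "real^'m \<Rightarrow> complex"
  assumes v: "torus_smooth v"
  shows "continuous_on (UNIV \<times> cbox 0 1)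
    (\<lambda>(\<phi>,s). complex_of_real s * cis (\<beta> * ln s) * v (\<phi> - ln s *\<^sub>R \<omega>))"
    (is "continuous_on ?S ?g")
  unfolding continuous_on_eq_continuous_within
proof
  fix p :: "(real^'m) \<times> real" assume "p \<in> ?S"
  then have "snd p = 0 \<or> snd p > 0" by auto
  then show "continuous (at p within ?S) ?g"
  proof
    assume p: "snd p = 0"
    obtain B where B: "\<And>\<phi>. norm (v \<phi>) \<le> B"
      using torus_smooth_bounded[OF v] by blast
    have "((\<lambda>q. \<bar>snd q\<bar> * B) \<longlongrightarrow> \<bar>snd p\<bar> * B) (at p within ?S)"
      by (intro tendsto_intros)
    then have "((\<lambda>q. \<bar>snd q\<bar> * B) \<longlongrightarrow> 0) (at p within ?S)"
      by (simp add: p)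
    moreover have "norm (?g q) \<le> \<bar>snd q\<bar> * B" for q
      using B by (auto simp: split_beta norm_mult intro: mult_left_mono)
    ultimately have "(?g \<longlongrightarrow> 0) (at p within ?S)"
      by (intro Lim_null_comparison[of ?g]) auto
    then show ?thesis
      using p by (simp add: continuous_within split_beta)
  next
    assume p: "snd p > 0"
    have "continuous_on (UNIV \<times> {0<..}) ?g"
      unfolding split_beta
      by (intro continuous_intros continuous_on_compose2[OF smooth_continuous_on[OF torus_smooth_smooth[OF v], of UNIV]])
        auto
    then have "isCont ?g p"
      using p by (intro continuous_on_interior) (auto simp: interior_open open_Times mem_Times_iff)
    then show ?thesis
      by (rule continuous_at_imp_continuous_within)
  qed
qed

lemma damped_flow_integral_has_derivative:
  assumes v: "torus_smooth v"
  shows "(damped_flow_integral \<beta> \<omega> v has_derivative (\<lambda>w. damped_flow_integral \<beta> \<omega> (dderiv w v) \<phi>)) (at \<phi>)"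
  unfolding damped_flow_integral_def
proof (rule parametric_integral_has_derivative[where
      f'="\<lambda>\<phi> s w. complex_of_real s * cis (\<beta> * ln s) * dderiv w v (\<phi> - ln s *\<^sub>R \<omega>)"])
  fix \<phi> and s :: real
  have "((\<lambda>x. v (x - ln s *\<^sub>R \<omega>)) has_derivative (\<lambda>w. dderiv w v (\<phi> - ln s *\<^sub>R \<omega>))) (at \<phi>)"
    using has_derivative_compose[of "\<lambda>x. x - ln s *\<^sub>R \<omega>" "\<lambda>v. v" \<phi> UNIV v]
      torus_smooth_has_derivative[OF v]
    by (simp add: has_derivative_diff[OF has_derivative_ident has_derivative_const, simplified] dderiv_def)
  then show "((\<lambda>x. complex_of_real s * cis (\<beta> * ln s) * v (x - ln s *\<^sub>R \<omega>)) has_derivative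
      (\<lambda>w. complex_of_real s * cis (\<beta> * ln s) * dderiv w v (\<phi> - ln s *\<^sub>R \<omega>))) (at \<phi>)"
    by (rule has_derivative_mult_right)
qed (use v in \<open>auto intro: continuous_on_damped_integrand[unfolded cbox_interval] torus_smooth_dderiv\<close>)

text \<open>Differentiating in direction w only replaces \<open>v\<close> by
  \<open>dderiv w v\<close>, again a smooth torus map; hence the induction on the order of
  differentiability is over all \<open>v\<close> simultaneously.\<close>

lemma torus_smooth_damped_flow_integral:
  assumes "torus_smooth v" shows "torus_smooth (damped_flow_integral \<beta> \<omega> v)"
  unfolding torus_smooth_def smooth_def
proof (intro conjI allI)
  show "Ck n (damped_flow_integral \<beta> \<omega> v)" for n
    using assms
  proof (induction n arbitrary: v)
    case 0
    then show ?case
      using continuous_on_parametric_integral[OF continuous_on_damped_integrand[OF 0]]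
      by (simp add: damped_flow_integral_def[abs_def])
  next
    case (Suc n)
    then show ?case
      by (intro Ck_SucI[OF damped_flow_integral_has_derivative]) (auto intro: torus_smooth_dderiv)
  qed
  fix \<phi> k
  have "v (\<phi> + (2 * pi) *\<^sub>R ivec k - x) = v (\<phi> - x)" for x
    using torus_smooth_periodic[OF assms, of "\<phi> - x" k] by (simp add: algebra_simps)
  then show "damped_flow_integral \<beta> \<omega> v (\<phi> + (2 * pi) *\<^sub>R ivec k) = damped_flow_integral \<beta> \<omega> v \<phi>"
    by (simp add: damped_flow_integral_def)
qed

text \<open>Up to sign, a solution is the integral \<open>\<integral>\<^sub>0\<^sup>\<infinity> e\<^bsup>-(2+i\<beta>)t\<^esup> v(\<phi> + t\<omega>) dt\<close>; the substitution
  \<open>s = e\<^bsup>-t\<^esup>\<close> turns it into \<open>damped_flow_integral\<close>, whose integrand is continuous up to \<open>s = 0\<close>.\<close>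

lemma dderiv_damped_flow_integral:
  assumes v: "torus_smooth v"
  shows "dderiv \<omega> (damped_flow_integral \<beta> \<omega> v) \<phi> =
    (2 + \<i> * of_real \<beta>) * damped_flow_integral \<beta> \<omega> v \<phi> - v \<phi>"
proof -
  define k where "k s = complex_of_real s * cis (\<beta> * ln s)" for s
  let ?l = "2 + \<i> * of_real \<beta>" and ?x = "\<lambda>s. \<phi> - ln s *\<^sub>R \<omega>"
  have cont: "continuous_on {0..1} (\<lambda>s. k s * u (?x s))" if "torus_smooth u" for u
    using continuous_on_compose2[OF continuous_on_damped_integrand[OF that, of \<beta> \<omega>], of "{0..1}" "\<lambda>s. (\<phi>, s)"]
    by (simp add: k_def continuous_on_Pair continuous_on_id continuous_on_const image_subset_iff)
  \<comment> \<open>The antiderivative carries the weight s^2: differentiating s^2 cis(beta ln s)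
    gives (2 + i beta) s cis(beta ln s), which is the origin of \<open>?l\<close>, and one factor s
    cancels the 1/s that comes from \<open>ln s\<close> inside \<open>v\<close>.\<close>
  have der: "((\<lambda>s. complex_of_real s * (k s * v (?x s))) has_vector_derivative
      ?l * (k s * v (?x s)) - k s * dderiv \<omega> v (?x s)) (at s)" if s: "s > 0" for s
  proof -
    have "((\<lambda>s. v (?x s)) has_derivative (\<lambda>h. frechet_derivative v (at (?x s)) (- (h / s) *\<^sub>R \<omega>))) (at s)"
      using s by (intro has_derivative_compose[OF _ torus_smooth_has_derivative[OF v]])
        (auto intro!: derivative_eq_intros simp: field_simps)
    moreover have "frechet_derivative v (at y) (- (h / s) *\<^sub>R \<omega>) = h *\<^sub>R (- dderiv \<omega> v y / s)" for h y
      using linear_scale[OF smooth_linear[OF torus_smooth_smooth[OF v]], of y "- (h/s)" \<omega>]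
      by (simp add: dderiv_def scaleR_conv_of_real)
    ultimately have 1: "((\<lambda>s. v (?x s)) has_vector_derivative - dderiv \<omega> v (?x s) / s) (at s)"
      by (simp add: has_vector_derivative_def)
    have 2: "((\<lambda>s. cis (\<beta> * ln s)) has_vector_derivative (\<beta> / s) *\<^sub>R (\<i> * cis (\<beta> * ln s))) (at s)"
      using s unfolding has_vector_derivative_def
      by (auto intro!: derivative_eq_intros simp: field_simps)
    have 3: "(complex_of_real has_vector_derivative 1) (at s)"
      using has_vector_derivative_of_real[OF DERIV_ident] by simp
    have "((\<lambda>s. complex_of_real s * (complex_of_real s * cis (\<beta> * ln s) * v (?x s))) has_vector_derivative
       complex_of_real s * (complex_of_real s * cis (\<beta> * ln s) * (- dderiv \<omega> v (?x s) / s) +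
         (complex_of_real s * ((\<beta> / s) *\<^sub>R (\<i> * cis (\<beta> * ln s))) + 1 * cis (\<beta> * ln s)) * v (?x s)) +
       1 * (complex_of_real s * cis (\<beta> * ln s) * v (?x s))) (at s)"
      by (intro has_vector_derivative_mult 1 2 3)
    moreover have "complex_of_real s * (complex_of_real s * cis (\<beta> * ln s) * (- dderiv \<omega> v (?x s) / s) +
         (complex_of_real s * ((\<beta> / s) *\<^sub>R (\<i> * cis (\<beta> * ln s))) + 1 * cis (\<beta> * ln s)) * v (?x s)) +
       1 * (complex_of_real s * cis (\<beta> * ln s) * v (?x s)) =
       ?l * (k s * v (?x s)) - k s * dderiv \<omega> v (?x s)"
      using s by (simp add: k_def scaleR_conv_of_real field_simps)
    ultimately show ?thesis by (simp add: k_def)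
  qed
  \<comment> \<open>The derivative is known for s > 0 only, so continuity up to s = 0 is what allows
    integration over [0,1]. The boundary term at s = 1 is \<open>v \<phi>\<close> because
    \<open>ln 1 = 0\<close>, the one at s = 0 vanishes.\<close>
  have "((\<lambda>s. ?l * (k s * v (?x s)) - k s * dderiv \<omega> v (?x s)) has_integral
      (of_real 1 * (k 1 * v (?x 1)) - of_real 0 * (k 0 * v (?x 0)))) {0..1}"
    by (rule fundamental_theorem_of_calculus_interior) (auto intro!: der continuous_intros cont v)
  then have "integral {0..1} (\<lambda>s. ?l * (k s * v (?x s)) - k s * dderiv \<omega> v (?x s)) = v \<phi>"
    by (simp add: has_integral_iff k_def)
  moreover have "integral {0..1} (\<lambda>s. ?l * (k s * v (?x s)) - k s * dderiv \<omega> v (?x s)) =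
     ?l * integral {0..1} (\<lambda>s. k s * v (?x s)) - integral {0..1} (\<lambda>s. k s * dderiv \<omega> v (?x s))"
    by (subst integral_diff) (auto intro!: integrable_continuous_real continuous_intros cont v torus_smooth_dderiv)
  moreover have "dderiv \<omega> (damped_flow_integral \<beta> \<omega> v) \<phi> = damped_flow_integral \<beta> \<omega> (dderiv \<omega> v) \<phi>"
    by (rule dderiv_eqI[OF damped_flow_integral_has_derivative[OF v]])
  ultimately show ?thesis
    by (simp add: damped_flow_integral_def k_def algebra_simps)
qed

lemma scalar_flow_equation_pos:
  fixes v :: "real^'m \<Rightarrow> complex"
  assumes v: "torus_smooth v" and l: "Re l > 0"
  shows "\<exists>u. torus_smooth u \<and> (\<forall>\<phi>. dderiv \<omega> u \<phi> = l * u \<phi> + v \<phi>)"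
proof -
  \<comment> \<open>Dividing the equation by \<open>a\<close> gives the coefficient l / a, of real
    part 2, which is the case treated by \<open>damped_flow_integral\<close>. The direction becomes
    omega / a, and \<open>- v\<close> compensates the sign in
    \<open>dderiv_damped_flow_integral\<close>.\<close>
  define a where "a = Re l / 2"
  define u where "u = damped_flow_integral (Im l / a) (inverse a *\<^sub>R \<omega>) (\<lambda>\<phi>. - (v \<phi>) / a)"
  have a: "a > 0" using l by (simp add: a_def)
  have v': "torus_smooth (\<lambda>\<phi>. - (v \<phi>) / a)"
    using torus_smooth_bounded_linear[OF bounded_linear_mult_right[of "- 1 / complex_of_real a"] v] by simp
  have u: "torus_smooth u"
    unfolding u_def by (rule torus_smooth_damped_flow_integral[OF v'])
  have l_eq: "2 + \<i> * of_real (Im l / a) = l / a"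
    using a by (auto simp: complex_eq_iff a_def field_simps)
  have "inverse a *\<^sub>R dderiv \<omega> u \<phi> = l / a * u \<phi> + v \<phi> / a" for \<phi>
    using dderiv_damped_flow_integral[OF v', of "inverse a *\<^sub>R \<omega>" "Im l / a" \<phi>, folded u_def, unfolded l_eq]
    by (simp add: dderiv_scaleR_direction[OF u])
  then have "dderiv \<omega> u \<phi> = l * u \<phi> + v \<phi>" for \<phi>
    using a by (simp add: scaleR_conv_of_real divide_simps)
  with u show ?thesis by blast
qed

lemma scalar_flow_equation:
  fixes v :: "real^'m \<Rightarrow> complex"
  assumes v: "torus_smooth v" and l: "Re l \<noteq> 0"
  obtains u where "torus_smooth u" "\<And>\<phi>. dderiv \<omega> u \<phi> = l * u \<phi> + v \<phi>"
proof (cases "Re l > 0")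
  case True
  then show ?thesis using scalar_flow_equation_pos[OF v] that by blast
next
  case False
  have v': "torus_smooth (\<lambda>\<phi>. - v \<phi>)"
    by (rule torus_smooth_bounded_linear[OF bounded_linear_minus[OF bounded_linear_ident] v])
  obtain u where u: "torus_smooth u" "\<And>\<phi>. dderiv (- \<omega>) u \<phi> = - l * u \<phi> + - v \<phi>"
    using scalar_flow_equation_pos[OF v', of "- l"] False l by auto
  have "dderiv \<omega> u \<phi> = l * u \<phi> + v \<phi>" for \<phi>
    using u(2)[of \<phi>] unfolding dderiv_uminus_direction[OF u(1)]
    by (metis add_uminus_conv_diff minus_add_distrib minus_minus mult_minus_left)
  with u(1) show ?thesis by (rule that)
qed

section \<open>The hyperbolic linear equation\<close>

text \<open>This is p(A) x. Powers of \<open>A\<close> appear as iterates of a linear map, so p(A)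
  is visibly a bounded linear operator and can be applied pointwise to torus maps.\<close>

definition poly_matrix_vector :: "complex^'n::finite^'n \<Rightarrow> complex poly \<Rightarrow> complex^'n \<Rightarrow> complex^'n" where
  "poly_matrix_vector A p x = (\<Sum>i\<le>degree p. coeff p i *s ((*v) A ^^ i) x)"

lemma bounded_linear_matrix_vector: "bounded_linear ((*v) (A :: complex^'n::finite^'m::finite))"
  by (rule matrix_vector_mul_bounded_linear)

lemma bounded_linear_vector_scalar_mult: "bounded_linear ((*s) (c::complex) :: complex^'n::finite \<Rightarrow> _)"
  by (intro linear_conv_bounded_linear[THEN iffD1] linearI) (auto simp: vec_eq_iff algebra_simps)

lemma bounded_linear_funpow:
  fixes f :: "'a::real_normed_vector \<Rightarrow> 'a"
  shows "bounded_linear f \<Longrightarrow> bounded_linear (f ^^ i)"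
  by (induction i) (auto intro: bounded_linear_compose bounded_linear_ident simp: id_def o_def)

lemma bounded_linear_poly_matrix_vector: "bounded_linear (poly_matrix_vector A p)"
  unfolding poly_matrix_vector_def[abs_def]
  by (intro bounded_linear_sum bounded_linear_compose[OF bounded_linear_vector_scalar_mult]
      bounded_linear_funpow bounded_linear_matrix_vector)

lemma poly_matrix_vector_eq:
  assumes "degree p < n"
  shows "poly_matrix_vector A p x = (\<Sum>i<n. coeff p i *s ((*v) A ^^ i) x)"
  unfolding poly_matrix_vector_def
  by (rule sum.mono_neutral_left) (use assms in \<open>auto simp: coeff_eq_0\<close>)

lemma poly_matrix_vector_smult:
  "c *s poly_matrix_vector A p x = poly_matrix_vector A p (c *s x)"
proof -
  have "((*v) A ^^ i) (c *s x) = c *s ((*v) A ^^ i) x" for i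
    by (induction i) (auto simp: vector_scalar_commute)
  then show ?thesis
    by (simp add: poly_matrix_vector_def vec_eq_iff sum_distrib_left ac_simps)
qed

lemma poly_matrix_vector_commute:
  "A *v poly_matrix_vector A p x = poly_matrix_vector A p (A *v x)"
proof -
  have "A *v poly_matrix_vector A p x = (\<Sum>i\<le>degree p. A *v (coeff p i *s ((*v) A ^^ i) x))"
    unfolding poly_matrix_vector_def
    by (rule linear_sum[OF bounded_linear.linear[OF bounded_linear_matrix_vector]])
  then show ?thesis
    by (simp add: poly_matrix_vector_def vector_scalar_commute funpow_swap1)
qed

text \<open>In operator terms p(A) = q(A) (A - l). The coefficients of (X - l) q are those of X q,
  that is \<open>pCons 0 q\<close>, minus l times those of q; a common summation bound lets the sums
  be separated termwise.\<close>

lemma poly_matrix_vector_root: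
  "poly_matrix_vector A ([:-l, 1:] * q) x = poly_matrix_vector A q (A *v x - l *s x)"
proof -
  let ?n = "Suc (degree q)" and ?T = "(*v) A"
  have "degree ([:-l, 1:] * q) < Suc ?n"
    by (rule le_less_trans[OF degree_mult_le]) simp
  then have "poly_matrix_vector A ([:-l, 1:] * q) x =
      (\<Sum>i<Suc ?n. coeff ([:-l, 1:] * q) i *s (?T ^^ i) x)"
    by (rule poly_matrix_vector_eq)
  also have "\<dots> = (\<Sum>i<Suc ?n. coeff (pCons 0 q) i *s (?T ^^ i) x) - l *s (\<Sum>i<Suc ?n. coeff q i *s (?T ^^ i) x)"
    by (simp add: vec_eq_iff sum_distrib_left sum_subtractf algebra_simps sum.distrib del: sum.lessThan_Suc)
  also have "(\<Sum>i<Suc ?n. coeff (pCons 0 q) i *s (?T ^^ i) x) = (\<Sum>i<?n. coeff q i *s (?T ^^ i) (A *v x))"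
    by (subst sum.lessThan_Suc_shift) (simp add: funpow_swap1)
  also have "\<dots> = poly_matrix_vector A q (A *v x)"
    by (rule poly_matrix_vector_eq[symmetric]) simp
  also have "(\<Sum>i<Suc ?n. coeff q i *s (?T ^^ i) x) = poly_matrix_vector A q x"
    by (rule poly_matrix_vector_eq[symmetric]) simp
  finally show ?thesis
    by (simp add: poly_matrix_vector_smult
        linear_diff[OF bounded_linear.linear[OF bounded_linear_poly_matrix_vector]])
qed

text \<open>With d the real dimension of the space of matrices, the d + 1 powers from the identity
  to the d-th are linearly dependent, already over the reals. Dependence is a property of a set, so
  two coinciding powers form a separate case, where their difference gives the polynomial.\<close>

lemma exists_annihilating_polynomial:
  fixes A :: "complex^'n::finite^'n"
  obtains p where "p \<noteq> 0" "\<And>x. poly_matrix_vector A p x = 0"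
proof -
  define P where "P i = ((**) A ^^ i) (mat 1)" for i
  define d where "d = DIM(complex^'n^'n)"
  have P: "P i *v x = ((*v) A ^^ i) x" for i x
    by (induction i) (auto simp: P_def matrix_vector_mul_assoc[symmetric])
  obtain c :: "nat \<Rightarrow> real" and j where c: "j \<le> d" "c j \<noteq> 0" "(\<Sum>i\<le>d. c i *\<^sub>R P i) = 0"
  proof (cases "inj_on P {..d}")
    case True
    then have "dependent (P ` {..d})"
      by (intro dependent_biggerset) (auto simp: card_image d_def)
    then obtain u v where "v \<in> P ` {..d}" "u v \<noteq> 0" "(\<Sum>v\<in>P ` {..d}. u v *\<^sub>R v) = 0"
      by (auto simp: dependent_finite)
    then show ?thesis
      using that[of _ "u \<circ> P"] by (auto simp: sum.reindex[OF True])
  next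
    case False
    then obtain i j where ij: "i \<le> d" "j \<le> d" "i \<noteq> j" "P i = P j"
      by (auto simp: inj_on_def)
    have "(\<Sum>k\<le>d. (of_bool (k = i) - of_bool (k = j)) *\<^sub>R P k) = 0"
      using ij by (simp add: scaleR_diff_left sum_subtractf of_bool_def if_distrib[of "\<lambda>c. c *\<^sub>R _"] cong: if_cong)
    then show ?thesis
      using that[of i "\<lambda>k. of_bool (k = i) - of_bool (k = j)"] ij by auto
  qed
  define p where "p = (\<Sum>i\<le>d. monom (complex_of_real (c i)) i)"
  have coeff_p: "coeff p i = (if i \<le> d then complex_of_real (c i) else 0)" for i
    by (simp add: p_def coeff_sum)
  have "degree p < Suc d"
    unfolding less_Suc_eq_le by (rule degree_le) (simp add: coeff_p)
  then have "poly_matrix_vector A p x = (\<Sum>i\<le>d. coeff p i *s (P i *v x))" for x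
    by (simp add: poly_matrix_vector_eq P lessThan_Suc_atMost)
  also have "\<dots> x = (\<Sum>i\<le>d. (c i *\<^sub>R P i) *v x)" for x
    by (intro sum.cong) (auto simp: coeff_p vec_eq_iff matrix_vector_mult_def sum_distrib_left
        scaleR_conv_of_real[of _ "_ :: complex"] ac_simps)
  also have "\<dots> x = (\<Sum>i\<le>d. c i *\<^sub>R P i) *v x" for x
    by (simp add: matrix_vector_mult_def vec_eq_iff sum_distrib_right) (auto intro: sum.swap)
  finally have "poly_matrix_vector A p x = 0" for x
    using c(3) by simp
  moreover have "p \<noteq> 0"
    using coeff_p[of j] c by auto
  ultimately show ?thesis using that by blast
qed

lemma mat_matrix_vector: "mat c *v x = c *s (x :: 'a::comm_semiring_1^'n::finite)"
  by (simp add: vec_eq_iff matrix_vector_mult_def mat_def if_distrib[of "\<lambda>a. a * _"] cong: if_cong)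

lemma invertible_if_injective:
  fixes A :: "'a::field^'n::finite^'n"
  assumes "\<And>x. A *v x = 0 \<Longrightarrow> x = 0" shows "invertible A"
  using assms by (simp add: invertible_left_inverse matrix_left_invertible_ker)

lemma dderiv_vec_nth: "torus_smooth f \<Longrightarrow> dderiv \<omega> f \<phi> $ i = dderiv \<omega> (\<lambda>\<phi>. f \<phi> $ i) \<phi>"
  by (simp add: dderiv_bounded_linear[OF bounded_linear_vec_nth])

lemma eigenvalue_flow_equation:
  fixes R :: "real^'m \<Rightarrow> complex^'n"
  assumes R: "torus_smooth R" and l: "Re l \<noteq> 0"
  obtains w where "torus_smooth w" "\<And>\<phi>. dderiv \<omega> w \<phi> = l *s w \<phi> + R \<phi>"
proof -
  have "\<exists>u. torus_smooth u \<and> (\<forall>\<phi>. dderiv \<omega> u \<phi> = l * u \<phi> + R \<phi> $ i)" for i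
    using scalar_flow_equation[OF torus_smooth_vec_nth[OF R] l] by metis
  then obtain u where u: "\<And>i. torus_smooth (u i)" "\<And>i \<phi>. dderiv \<omega> (u i) \<phi> = l * u i \<phi> + R \<phi> $ i"
    by metis
  let ?w = "\<lambda>\<phi>. \<chi> i. u i \<phi>"
  have w: "torus_smooth ?w"
    by (rule torus_smooth_cart) (simp add: u)
  moreover have "dderiv \<omega> ?w \<phi> = l *s ?w \<phi> + R \<phi>" for \<phi>
    by (simp add: vec_eq_iff dderiv_vec_nth[OF w] u)
  ultimately show ?thesis by (rule that)
qed

text \<open>Each factor \<open>X - l\<close> of \<open>p\<close> is absorbed either by solving the scalar equation (if \<open>l\<close> is an
  eigenvalue, hence not imaginary) or by inverting \<open>A - l\<close>. With an annihilating \<open>p\<close> the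
  remainder vanishes, so that no normal form of \<open>A\<close> is needed.\<close>

lemma flow_equation_modulo_polynomial:
  fixes A :: "complex^'n^'n" and V :: "real^'m \<Rightarrow> complex^'n"
  assumes hyp: "\<And>z v. v \<noteq> 0 \<Longrightarrow> A *v v = z *s v \<Longrightarrow> Re z \<noteq> 0"
    and V: "torus_smooth V" and "p \<noteq> 0"
  shows "\<exists>h R. torus_smooth h \<and> torus_smooth R \<and>
    (\<forall>\<phi>. dderiv \<omega> h \<phi> - A *v h \<phi> = V \<phi> - poly_matrix_vector A p (R \<phi>))"
  using \<open>p \<noteq> 0\<close>
proof (induction "degree p" arbitrary: p)
  case 0
  then obtain c where c: "p = [:c:]" "c \<noteq> 0"
    by (metis degree_eq_zeroE pCons_0_0)
  \<comment> \<open>For a constant p = c, p(A) is multiplication by c: take h = 0 and let R = V / c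
    absorb the whole right-hand side.\<close>
  have "torus_smooth (\<lambda>\<phi>. inverse c *s V \<phi>)"
    by (rule torus_smooth_bounded_linear[OF bounded_linear_vector_scalar_mult V])
  moreover have "dderiv \<omega> (\<lambda>\<phi>. 0) \<phi> - A *v 0 = V \<phi> - poly_matrix_vector A p (inverse c *s V \<phi>)" for \<phi>
    using c by (simp add: poly_matrix_vector_def dderiv_eqI[OF has_derivative_const] vec_eq_iff)
  ultimately show ?case
    using torus_smooth_const by blast
next
  case (Suc n)
  then obtain l where "poly p l = 0"
    using fundamental_theorem_of_algebra[of p] by (auto simp: constant_degree)
  then obtain q where p: "p = [:-l, 1:] * q"
    by (auto simp: poly_eq_0_iff_dvd dvd_def)
  with Suc have q: "q \<noteq> 0" "n = degree q"
    by (auto simp: degree_mult_eq simp del: mult_pCons_left)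
  then obtain h R where h: "torus_smooth h" and R: "torus_smooth R"
    and eq: "\<And>\<phi>. dderiv \<omega> h \<phi> - A *v h \<phi> = V \<phi> - poly_matrix_vector A q (R \<phi>)"
    using Suc.hyps(1) by blast
  let ?q = "poly_matrix_vector A q"
  note lin_q = bounded_linear.linear[OF bounded_linear_poly_matrix_vector, of A q]
  show ?case
  proof (cases "\<exists>v. v \<noteq> 0 \<and> A *v v = l *s v")
    case True
    then obtain w where w: "torus_smooth w" "\<And>\<phi>. dderiv \<omega> w \<phi> = l *s w \<phi> + R \<phi>"
      using hyp eigenvalue_flow_equation[OF R] by metis
    have qw: "torus_smooth (\<lambda>\<phi>. ?q (w \<phi>))"
      by (rule torus_smooth_bounded_linear[OF bounded_linear_poly_matrix_vector w(1)])
    \<comment> \<open>Applying the flow operator to the correction q(A) w gives q(A) (l w + R - A w)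
      = q(A) R - p(A) w: the old remainder cancels and \<open>w\<close> becomes the new one.\<close>
    have "dderiv \<omega> (\<lambda>\<phi>. h \<phi> + ?q (w \<phi>)) \<phi> - A *v (h \<phi> + ?q (w \<phi>)) =
        V \<phi> - poly_matrix_vector A p (w \<phi>)" for \<phi>
    proof -
      have "dderiv \<omega> (\<lambda>\<phi>. h \<phi> + ?q (w \<phi>)) \<phi> - A *v (h \<phi> + ?q (w \<phi>)) =
          (dderiv \<omega> h \<phi> - A *v h \<phi>) + (?q (l *s w \<phi> + R \<phi>) - ?q (A *v w \<phi>))"
        by (simp add: dderiv_add[OF h qw] w(2) poly_matrix_vector_commute
            dderiv_bounded_linear[OF bounded_linear_poly_matrix_vector w(1)] matrix_vector_right_distrib)
      then show ?thesis
        by (simp only: eq p poly_matrix_vector_root) (simp add: linear_add[OF lin_q] linear_diff[OF lin_q])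
    qed
    moreover have "torus_smooth (\<lambda>\<phi>. h \<phi> + ?q (w \<phi>))"
      by (rule torus_smooth_add[OF h qw])
    ultimately show ?thesis
      using w(1) by blast
  next
    case False
    have diff: "(A - mat l) *v x = A *v x - l *s x" for x
      by (simp add: matrix_vector_mult_diff_rdistrib mat_matrix_vector)
    have "invertible (A - mat l)"
      using False by (intro invertible_if_injective) (auto simp: diff)
    then obtain B where B: "(A - mat l) ** B = mat 1"
      by (auto simp: invertible_def)
    \<comment> \<open>Here h stays the same and only the remainder is rewritten: p(A) B R = q(A) (A
      - l) B R = q(A) R.\<close>
    have "A *v (B *v x) - l *s (B *v x) = x" for x
      unfolding diff[symmetric] by (simp add: matrix_vector_mul_assoc B)
    then have "dderiv \<omega> h \<phi> - A *v h \<phi> = V \<phi> - poly_matrix_vector A p (B *v R \<phi>)" for \<phi>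
      by (simp only: eq p poly_matrix_vector_root)
    moreover have "torus_smooth (\<lambda>\<phi>. B *v R \<phi>)"
      by (rule torus_smooth_bounded_linear[OF bounded_linear_matrix_vector R])
    ultimately show ?thesis
      using h by blast
  qed
qed

definition complex_vector :: "real^'n::finite \<Rightarrow> complex^'n" where
  "complex_vector x = (\<chi> i. complex_of_real (x $ i))"

text \<open>A real \<open>L\<close> may have complex eigenvalues, so the equation is solved over the
  complex numbers. As \<open>L\<close>, omega and \<open>V\<close> are real, the real part of that
  solution solves the original equation.\<close>

lemma hyperbolic_flow_equation:
  fixes L :: "real^'n^'n" and V :: "real^'m \<Rightarrow> real^'n"
  assumes L: "hyperbolic_matrix L" and V: "torus_smooth V"
  obtains h where "torus_smooth h" "\<And>\<phi>. dderiv \<omega> h \<phi> - L *v h \<phi> = V \<phi>"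
proof -
  define re :: "complex^'n \<Rightarrow> real^'n" where "re z = (\<chi> i. Re (z $ i))" for z
  have bl_c: "bounded_linear (complex_vector :: real^'n \<Rightarrow> _)"
    by (intro linear_conv_bounded_linear[THEN iffD1] linearI) (auto simp: complex_vector_def vec_eq_iff scaleR_conv_of_real[of _ "_ :: complex"])
  have bl_re: "bounded_linear re"
    by (intro linear_conv_bounded_linear[THEN iffD1] linearI) (auto simp: re_def vec_eq_iff)
  obtain p where p: "p \<noteq> 0" "\<And>x. poly_matrix_vector (cmat L) p x = 0"
    using exists_annihilating_polynomial[of "cmat L"] by metis
  obtain h where h: "torus_smooth h"
    and eq: "\<And>\<phi>. dderiv \<omega> h \<phi> - cmat L *v h \<phi> = complex_vector (V \<phi>)"
    using flow_equation_modulo_polynomial[of "cmat L" "\<lambda>\<phi>. complex_vector (V \<phi>)" p \<omega>] p L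
      torus_smooth_bounded_linear[OF bl_c V]
    by (auto simp: hyperbolic_matrix_def)
  have "re (cmat L *v x) = L *v re x" for x
    by (simp add: re_def cmat_def map_matrix_def matrix_vector_mult_def vec_eq_iff)
  then have "dderiv \<omega> (\<lambda>\<phi>. re (h \<phi>)) \<phi> - L *v re (h \<phi>) = re (dderiv \<omega> h \<phi> - cmat L *v h \<phi>)" for \<phi>
    by (simp add: dderiv_bounded_linear[OF bl_re h] linear_diff[OF bounded_linear.linear[OF bl_re]])
  then have "dderiv \<omega> (\<lambda>\<phi>. re (h \<phi>)) \<phi> - L *v re (h \<phi>) = V \<phi>" for \<phi>
    by (simp add: eq) (simp add: re_def complex_vector_def vec_eq_iff)
  then show ?thesis
    using that torus_smooth_bounded_linear[OF bl_re h] by blast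
qed

section \<open>Fourier coefficients\<close>

abbreviation cube :: "(real^'m::finite) set" where
  "cube \<equiv> cbox 0 (\<chi> l. 2 * pi)"

lemma axis_one_in_Basis: "axis i (1::real) \<in> Basis"
  by (simp add: axis_in_Basis_iff)

lemma ivec_axis: "ivec (axis i 1) = axis i 1"
  by (simp add: ivec_def axis_def vec_eq_iff)

lemma ivec_diff: "ivec (k - l) = ivec k - ivec l"
  and ivec_minus: "ivec (- k) = - ivec k"
  and ivec_zero: "ivec 0 = 0"
  by (auto simp: ivec_def vec_eq_iff)

lemma ivec_inner_ivec: "ivec k \<bullet> ivec l = of_int (\<Sum>i\<in>UNIV. k $ i * l $ i)"
  by (simp add: ivec_def inner_vec_def)

text \<open>Cut the translated cube along the face where the i-th coordinate is 2 pi; the part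
  beyond it, moved back by one period, fills the slab that the translation left empty.\<close>

lemma integral_cube_shift_axis:
  fixes f :: "real^'m \<Rightarrow> 'b::euclidean_space"
  assumes f: "continuous_on UNIV f" and per: "\<And>\<phi> k. f (\<phi> + (2 * pi) *\<^sub>R ivec k) = f \<phi>"
    and t: "0 \<le> t" "t \<le> 2 * pi"
  shows "integral cube (\<lambda>\<phi>. f (\<phi> + t *\<^sub>R axis i 1)) = integral cube f"
proof -
  let ?b = "\<chi> l::'m. 2 * pi" and ?e = "axis i 1 :: real^'m"
  have inner_e: "x \<bullet> ?e = x $ i" for x
    by (simp add: inner_axis)
  have nth_e: "?e $ j = of_bool (j = i)" for j
    by (auto simp: axis_def)
  have mem_box: "x \<in> cbox a b \<longleftrightarrow> a $ i \<le> x $ i \<and> x $ i \<le> b $ i \<and>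
      (\<forall>j. j \<noteq> i \<longrightarrow> a $ j \<le> x $ j \<and> x $ j \<le> b $ j)" for x a b :: "real^'m"
    unfolding mem_box_cart by metis
  have int: "f integrable_on cbox a b" for a b
    by (rule integrable_continuous) (rule continuous_on_subset[OF f], simp)
  have "integral cube (\<lambda>\<phi>. f (\<phi> + t *\<^sub>R ?e)) = integral (cbox (t *\<^sub>R ?e) (?b + t *\<^sub>R ?e)) f"
    using integral_shift_cbox[of "t *\<^sub>R ?e" "t *\<^sub>R ?e" "?b + t *\<^sub>R ?e" f] by simp
  also have "\<dots> = integral (cbox (t *\<^sub>R ?e) (?b + t *\<^sub>R ?e) \<inter> {x. x \<bullet> ?e \<le> 2 * pi}) f +
      integral (cbox (t *\<^sub>R ?e) (?b + t *\<^sub>R ?e) \<inter> {x. x \<bullet> ?e \<ge> 2 * pi}) f"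
    by (rule integral_split[OF int axis_one_in_Basis])
  also have "cbox (t *\<^sub>R ?e) (?b + t *\<^sub>R ?e) \<inter> {x. x \<bullet> ?e \<le> 2 * pi} = cube \<inter> {x. x \<bullet> ?e \<ge> t}"
    using t by (auto simp: mem_box inner_e nth_e)
  also have "cbox (t *\<^sub>R ?e) (?b + t *\<^sub>R ?e) \<inter> {x. x \<bullet> ?e \<ge> 2 * pi} =
      cbox ((2 * pi) *\<^sub>R ?e) (?b + t *\<^sub>R ?e)"
    using t by (auto simp: mem_box inner_e nth_e)
  also have "integral \<dots> f = integral (cbox 0 (?b + t *\<^sub>R ?e - (2 * pi) *\<^sub>R ?e)) f"
    using integral_shift_cbox[of "(2 * pi) *\<^sub>R ?e" "(2 * pi) *\<^sub>R ?e" "?b + t *\<^sub>R ?e" f, symmetric]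
      per[of _ "axis i 1"] by (simp add: ivec_axis)
  also have "cbox 0 (?b + t *\<^sub>R ?e - (2 * pi) *\<^sub>R ?e) = cube \<inter> {x. x \<bullet> ?e \<le> t}"
    using t by (auto simp: mem_box inner_e nth_e)
  also have "integral (cube \<inter> {x. x \<bullet> ?e \<ge> t}) f + integral \<dots> f = integral cube f"
    using integral_split[OF int axis_one_in_Basis, of 0 ?b i t] by simp
  finally show ?thesis .
qed

text \<open>The integral over translates is constant for shifts between 0 and 2 pi, so its
  derivative vanishes at the interior point pi. Differentiation under the integral identifies that
  derivative, and the same invariance undoes the shift by pi.\<close>

lemma integral_cube_dderiv_axis:
  fixes f :: "real^'m \<Rightarrow> 'b::euclidean_space"
  assumes f: "torus_smooth f"
  shows "integral cube (dderiv (axis i 1) f) = 0"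
proof -
  let ?e = "axis i 1 :: real^'m"
  let ?J = "\<lambda>t. integral cube (\<lambda>\<phi>. f (\<phi> + t *\<^sub>R ?e))"
  have cont: "continuous_on UNIV g" if "torus_smooth g" for g :: "real^'m \<Rightarrow> 'b"
    by (rule smooth_continuous_on[OF torus_smooth_smooth[OF that]])
  note shift = integral_cube_shift_axis[OF cont torus_smooth_periodic]
  have D: "torus_smooth (dderiv ?e f)"
    by (rule torus_smooth_dderiv[OF f])
  have joint: "continuous_on (UNIV \<times> cube) (\<lambda>(t, \<phi>). g (\<phi> + t *\<^sub>R ?e))"
    if "torus_smooth g" for g :: "real^'m \<Rightarrow> 'b"
    unfolding split_beta
    by (rule continuous_on_compose2[OF cont[OF that]]) (auto intro!: continuous_intros)
  have "(?J has_derivative (\<lambda>v. integral cube (\<lambda>\<phi>. v *\<^sub>R dderiv ?e f (\<phi> + pi *\<^sub>R ?e)))) (at pi)"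
  proof (rule parametric_integral_has_derivative[where f'="\<lambda>t \<phi> v. v *\<^sub>R dderiv ?e f (\<phi> + t *\<^sub>R ?e)"])
    show "((\<lambda>t. f (\<phi> + t *\<^sub>R ?e)) has_derivative (\<lambda>v. v *\<^sub>R dderiv ?e f (\<phi> + t *\<^sub>R ?e))) (at t)" for t \<phi>
      using has_vector_derivative_along_line[OF torus_smooth_has_derivative[OF f]]
      by (simp add: has_vector_derivative_def dderiv_def)
    show "continuous_on (UNIV \<times> cube) (\<lambda>(t, \<phi>). v *\<^sub>R dderiv ?e f (\<phi> + t *\<^sub>R ?e))" for v :: real
      using continuous_on_scaleR[OF continuous_on_const joint[OF D], of v] by (simp add: split_beta)
  qed (rule joint[OF f])
  moreover have "(?J has_derivative (\<lambda>v. 0)) (at pi)"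
    by (rule has_derivative_transform_within_open[OF has_derivative_const, of "{0<..<2 * pi}"])
      (auto simp: shift[OF f f])
  ultimately have "(\<lambda>v. integral cube (\<lambda>\<phi>. v *\<^sub>R dderiv ?e f (\<phi> + pi *\<^sub>R ?e))) = (\<lambda>v. 0)"
    by (rule has_derivative_unique)
  from fun_cong[OF this, of 1] show ?thesis
    by (simp add: shift[OF D D])
qed

lemma integral_cube_dderiv:
  fixes f :: "real^'m \<Rightarrow> 'b::euclidean_space"
  assumes f: "torus_smooth f"
  shows "integral cube (dderiv \<omega> f) = 0"
proof -
  have expand: "dderiv \<omega> f = (\<lambda>\<phi>. \<Sum>i\<in>UNIV. (\<omega> $ i) *\<^sub>R dderiv (axis i 1) f \<phi>)"
  proof
    fix \<phi>
    note lin = smooth_linear[OF torus_smooth_smooth[OF f]]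
    have "(\<Sum>i\<in>UNIV. (\<omega> $ i) *\<^sub>R axis i 1) = \<omega>"
      by (simp add: vec_eq_iff axis_def if_distrib cong: if_cong)
    then have "frechet_derivative f (at \<phi>) \<omega> = frechet_derivative f (at \<phi>) (\<Sum>i\<in>UNIV. (\<omega> $ i) *\<^sub>R axis i 1)"
      by simp
    then show "dderiv \<omega> f \<phi> = (\<Sum>i\<in>UNIV. (\<omega> $ i) *\<^sub>R dderiv (axis i 1) f \<phi>)"
      by (simp only: dderiv_def linear_sum[OF lin] linear_scale[OF lin])
  qed
  have "(dderiv v f) integrable_on cube" for v
    by (intro integrable_continuous smooth_continuous_on torus_smooth_smooth torus_smooth_dderiv f)
  then show ?thesis
    by (subst expand) (simp add: integral_sum integral_cube_dderiv_axis[OF f] integrable_cmul)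
qed

lemma cis_inner_has_derivative:
  "((\<lambda>\<phi>. c * cis (a \<bullet> \<phi>)) has_derivative (\<lambda>v. (c * (\<i> * (a \<bullet> v))) * cis (a \<bullet> \<phi>))) (at \<phi>)"
  by (auto intro!: derivative_eq_intros simp: scaleR_conv_of_real)

lemma torus_smooth_cis: "torus_smooth (\<lambda>\<phi>. cis (ivec k \<bullet> \<phi>))"
  unfolding torus_smooth_def smooth_def
proof (intro conjI allI)
  \<comment> \<open>A free constant \<open>c\<close> is needed for the induction, as each
    differentiation contributes a factor i <k,v>.\<close>
  have "Ck n (\<lambda>\<phi>. c * cis (ivec k \<bullet> \<phi>))" for n c
  proof (induction n arbitrary: c)
    case 0
    show ?case by (auto intro!: continuous_intros)
  next
    case (Suc n)
    show ?case by (rule Ck_SucI[OF cis_inner_has_derivative Suc])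
  qed
  from this[of _ 1] show "Ck n (\<lambda>\<phi>. cis (ivec k \<bullet> \<phi>))" for n
    by simp
  show "cis (ivec k \<bullet> (\<phi> + (2 * pi) *\<^sub>R ivec l)) = cis (ivec k \<bullet> \<phi>)" for \<phi> l
    by (simp add: inner_add_right ivec_inner_ivec cis_mult[symmetric] cis_multiple_2pi del: of_int_sum)
qed

lemma dderiv_cis: "dderiv \<omega> (\<lambda>\<phi>. cis (ivec k \<bullet> \<phi>)) \<phi> = \<i> * (\<omega> \<bullet> ivec k) * cis (ivec k \<bullet> \<phi>)"
  using dderiv_eqI[OF cis_inner_has_derivative[of 1 "ivec k" \<phi>], of \<omega>] by (simp add: inner_commute)

text \<open>If some component of k is nonzero, the exponential is a nonzero multiple of its own
  derivative along that axis, and such derivatives integrate to 0.\<close>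

lemma integral_cube_cis:
  "integral cube (\<lambda>\<phi>::real^'m. cis (ivec k \<bullet> \<phi>)) = (if k = 0 then of_real ((2 * pi) ^ CARD('m)) else 0)"
proof (cases "k = 0")
  case True
  have "measure lborel (cube :: (real^'m) set) = (2 * pi) ^ CARD('m)"
    by (subst content_cbox_cart) (auto simp: cbox_interval less_eq_vec_def interval_eq_empty_cart)
  with True show ?thesis
    by (simp add: ivec_zero scaleR_conv_of_real)
next
  case False
  then obtain i where i: "k $ i \<noteq> 0" by (auto simp: vec_eq_iff)
  have "axis i 1 \<bullet> ivec k = k $ i"
    by (simp add: ivec_def inner_axis')
  then have "integral cube (\<lambda>\<phi>. \<i> * of_int (k $ i) * cis (ivec k \<bullet> \<phi>)) = 0"
    using integral_cube_dderiv_axis[OF torus_smooth_cis[of k], of i] by (simp add: dderiv_cis[abs_def])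
  then show ?thesis
    using i False by simp
qed

section \<open>Unnormalised coefficients of complex functions and completeness of the
  exponentials\<close>

definition fourier_integral :: "(real^'m::finite \<Rightarrow> complex) \<Rightarrow> int^'m \<Rightarrow> complex" where
  "fourier_integral f k = integral cube (\<lambda>\<phi>. f \<phi> * cis (- (ivec k \<bullet> \<phi>)))"

lemma integrable_cube_cis:
  "continuous_on UNIV f \<Longrightarrow> (\<lambda>\<phi>. f \<phi> * cis (- (ivec k \<bullet> \<phi>))) integrable_on cube"
  by (intro integrable_continuous continuous_intros) (auto intro: continuous_on_subset)

lemma fourier_integral_add:
  assumes "continuous_on UNIV f" "continuous_on UNIV g"
  shows "fourier_integral (\<lambda>\<phi>. f \<phi> + g \<phi>) k = fourier_integral f k + fourier_integral g k"
  using integral_add[OF integrable_cube_cis[OF assms(1)] integrable_cube_cis[OF assms(2)]]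
  by (simp add: fourier_integral_def algebra_simps)

lemma fourier_integral_mult: "fourier_integral (\<lambda>\<phi>. c * f \<phi>) k = c * fourier_integral f k"
  by (simp add: fourier_integral_def mult.assoc)

lemma fourier_integral_sum:
  assumes "\<And>i. i \<in> I \<Longrightarrow> continuous_on UNIV (f i)"
  shows "fourier_integral (\<lambda>\<phi>. \<Sum>i\<in>I. f i \<phi>) k = (\<Sum>i\<in>I. fourier_integral (f i) k)"
  using assms
  by (induction I rule: infinite_finite_induct)
    (auto simp: fourier_integral_add continuous_on_sum, auto simp: fourier_integral_def)

text \<open>Integration by parts: the derivative of the periodic product f exp(-i<k,phi>) has
  integral 0.\<close>

lemma fourier_integral_dderiv:
  fixes f :: "real^'m \<Rightarrow> complex"
  assumes f: "torus_smooth f"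
  shows "fourier_integral (dderiv \<omega> f) k = \<i> * (\<omega> \<bullet> ivec k) * fourier_integral f k"
proof -
  let ?c = "\<lambda>\<phi>. cis (ivec (- k) \<bullet> \<phi>)"
  have "0 = integral cube (dderiv \<omega> (\<lambda>\<phi>. f \<phi> * ?c \<phi>))"
    by (rule integral_cube_dderiv[symmetric])
      (rule torus_smooth_bounded_bilinear[OF bounded_bilinear_mult f torus_smooth_cis])
  also have "dderiv \<omega> (\<lambda>\<phi>. f \<phi> * ?c \<phi>) =
      (\<lambda>\<phi>. dderiv \<omega> f \<phi> * cis (- (ivec k \<bullet> \<phi>)) + (- \<i> * (\<omega> \<bullet> ivec k) * f \<phi>) * cis (- (ivec k \<bullet> \<phi>)))"
    by (rule ext, subst dderiv_bounded_bilinear[OF bounded_bilinear_mult f torus_smooth_cis])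
      (simp only: dderiv_cis, simp add: ivec_minus)
  also have "integral cube \<dots> = fourier_integral (dderiv \<omega> f) k + fourier_integral (\<lambda>\<phi>. - \<i> * (\<omega> \<bullet> ivec k) * f \<phi>) k"
    unfolding fourier_integral_def
    by (rule integral_add; rule integrable_cube_cis)
      (intro continuous_intros smooth_continuous_on torus_smooth_smooth torus_smooth_dderiv f)+
  also have "\<dots> = fourier_integral (dderiv \<omega> f) k + - \<i> * (\<omega> \<bullet> ivec k) * fourier_integral f k"
    by (simp only: fourier_integral_mult)
  finally show ?thesis
    by (simp add: algebra_simps)
qed

lemma fourier_integral_cis:
  "fourier_integral (\<lambda>\<phi>::real^'m. cis (ivec l \<bullet> \<phi>)) k = (if k = l then of_real ((2 * pi) ^ CARD('m)) else 0)"
  using integral_cube_cis[of "l - k"] by (simp add: fourier_integral_def cis_mult ivec_diff inner_diff_left)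

text \<open>Stone--Weierstrass on the image of the torus in \<open>\<complex>\<^sup>m\<close>: the functions \<open>p\<close> all of whose
  coefficients vanish are stable under multiplication by polynomials in
  \<open>cos \<phi>\<^sub>i\<close> and \<open>sin \<phi>\<^sub>i\<close>.\<close>

lemma fourier_integral_polynomial_eq_0:
  fixes p :: "real^'m \<Rightarrow> complex"
  defines "\<psi> \<equiv> \<lambda>\<phi>::real^'m. \<chi> i. cis (\<phi> $ i)"
  assumes "real_polynomial_function q" "continuous_on UNIV p" "\<And>k. fourier_integral p k = 0"
  shows "fourier_integral (\<lambda>\<phi>. of_real (q (\<psi> \<phi>)) * p \<phi>) k = 0"
  using assms(2-)
proof (induction q arbitrary: p k)
  case (linear q)
  \<comment> \<open>Multiplication by \<open>cis\<close> of plus or minus a coordinate only moves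
    the Fourier index by one unit, which is harmless since all coefficients of \<open>p\<close>
    vanish.\<close>
  have shift: "fourier_integral (\<lambda>\<phi>. cis (s * \<phi> $ i) * p \<phi>) k = 0" if "s = 1 \<or> s = -1" for s i
  proof -
    let ?k = "k - (if s = 1 then axis i 1 else - axis i 1)"
    have "cis (s * \<phi> $ i) * p \<phi> * cis (- (ivec k \<bullet> \<phi>)) = p \<phi> * cis (- (ivec ?k \<bullet> \<phi>))" for \<phi>
      using that by (auto simp: cis_mult ivec_diff ivec_minus ivec_axis inner_diff_left inner_axis' inner_add_left)
    then show ?thesis
      using linear(3)[of ?k] by (simp only: fourier_integral_def)
  qed
  have cont: "continuous_on UNIV (\<lambda>\<phi>. cis (s * \<phi> $ i) * p \<phi>)" for s i
    by (intro continuous_intros linear(2))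
  have term_0: "fourier_integral (\<lambda>\<phi>. a * (cis (1 * \<phi> $ i) * p \<phi>) + b * (cis (-1 * \<phi> $ i) * p \<phi>)) k = 0"
    for a b i
    using shift[of 1 i] shift[of "-1" i]
    by (simp only: fourier_integral_add[OF continuous_on_mult_left[OF cont] continuous_on_mult_left[OF cont]]
        fourier_integral_mult) simp
  \<comment> \<open>\<open>q\<close> is linear over the reals only, so its values on both 1 and
    \<open>\<i>\<close> in each coordinate are needed; they multiply the real and imaginary parts of
    \<open>cis\<close>.\<close>
  have q: "q (\<psi> \<phi>) = (\<Sum>i\<in>UNIV. cos (\<phi> $ i) * q (axis i 1) + sin (\<phi> $ i) * q (axis i \<i>))" for \<phi>
  proof -
    have "\<psi> \<phi> = (\<Sum>i\<in>UNIV. cos (\<phi> $ i) *\<^sub>R axis i 1 + sin (\<phi> $ i) *\<^sub>R axis i \<i>)"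
      by (simp add: \<psi>_def vec_eq_iff axis_def sum.distrib if_distrib complex_eq_iff cong: if_cong)
    then show ?thesis
      by (simp add: linear_sum linear_add linear_scale bounded_linear.linear[OF linear(1)])
  qed
  have cos: "complex_of_real (cos x) = (cis (1 * x) + cis (-1 * x)) / 2"
    and sin: "complex_of_real (sin x) = (cis (1 * x) - cis (-1 * x)) / (2 * \<i>)" for x
    by (auto simp: complex_eq_iff)
  have "fourier_integral (\<lambda>\<phi>. of_real (q (\<psi> \<phi>)) * p \<phi>) k = fourier_integral (\<lambda>\<phi>. \<Sum>i\<in>UNIV.
      ((q (axis i 1) / 2 + q (axis i \<i>) / (2 * \<i>)) * (cis (1 * \<phi> $ i) * p \<phi>) +
       (q (axis i 1) / 2 - q (axis i \<i>) / (2 * \<i>)) * (cis (-1 * \<phi> $ i) * p \<phi>))) k"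
    by (rule arg_cong[where f="\<lambda>f. fourier_integral f k"], rule ext)
      (simp only: q of_real_sum of_real_add of_real_mult cos sin sum_distrib_right,
        rule sum.cong, auto simp: field_simps)
  also have "\<dots> = 0"
    by (subst fourier_integral_sum[OF continuous_on_add[OF continuous_on_mult_left[OF cont] continuous_on_mult_left[OF cont]]])
      (intro sum.neutral ballI term_0)
  finally show ?case .
next
  case (const c)
  then show ?case by (simp add: fourier_integral_mult)
next
  case (add q r)
  have cont: "continuous_on UNIV (\<lambda>\<phi>. complex_of_real (q (\<psi> \<phi>)) * p \<phi>)" if "real_polynomial_function q" for q
    unfolding \<psi>_def
    by (intro continuous_intros add.prems continuous_on_compose2[OF
        continuous_on_polymonial_function[OF that[unfolded real_polynomial_function_eq], of UNIV]]) auto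
  show ?case
    using add.IH[OF add.prems] fourier_integral_add[OF cont[OF add.hyps(1)] cont[OF add.hyps(2)]]
    by (simp add: distrib_right)
next
  case (mult q r)
  have "continuous_on UNIV (\<lambda>\<phi>. complex_of_real (r (\<psi> \<phi>)) * p \<phi>)"
    unfolding \<psi>_def
    by (intro continuous_intros mult.prems continuous_on_compose2[OF
        continuous_on_polymonial_function[OF mult.hyps(2)[unfolded real_polynomial_function_eq], of UNIV]]) auto
  \<comment> \<open>This is why \<open>p\<close> is arbitrary in the induction: the hypothesis for
    \<open>q\<close> is applied to the product of \<open>p\<close> with r(psi), whose coefficients
    vanish by the hypothesis for \<open>r\<close>.\<close>
  from mult.IH(1)[OF this mult.IH(2)[OF mult.prems]] show ?case
    by (simp add: mult.assoc)
qed

text \<open>Points with equal image under psi differ by periods, so \<open>f\<close> factors on the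
  cube as g after psi. The factor \<open>g\<close> is continuous: its preimage of a closed set is
  the psi-image of a compact set. Stone-Weierstrass then applies to \<open>g\<close> on the compact
  image.\<close>

lemma trigonometric_approximation:
  fixes f :: "real^'m \<Rightarrow> real"
  assumes f: "continuous_on UNIV f" and per: "\<And>\<phi> k. f (\<phi> + (2 * pi) *\<^sub>R ivec k) = f \<phi>" and "0 < \<epsilon>"
  obtains q :: "complex^'m \<Rightarrow> real"
  where "real_polynomial_function q" "\<And>\<phi>. \<phi> \<in> cube \<Longrightarrow> \<bar>f \<phi> - q (\<chi> i. cis (\<phi> $ i))\<bar> < \<epsilon>"
proof -
  let ?\<psi> = "\<lambda>\<phi>::real^'m. \<chi> i. cis (\<phi> $ i)"
  define g where "g = f \<circ> inv_into cube ?\<psi>"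
  have \<psi>: "continuous_on S ?\<psi>" for S
    by (intro continuous_intros)
  have "f \<phi> = f \<theta>" if eq: "?\<psi> \<phi> = ?\<psi> \<theta>" for \<phi> \<theta>
  proof -
    have "\<exists>n::int. \<phi> $ i = \<theta> $ i + 2 * pi * n" for i
      using eq by (auto simp: vec_eq_iff complex_eq_iff sin_cos_eq_iff[symmetric])
    then obtain n :: "'m \<Rightarrow> int" where "\<And>i. \<phi> $ i = \<theta> $ i + 2 * pi * n i"
      by metis
    then have "\<phi> = \<theta> + (2 * pi) *\<^sub>R ivec (\<chi> i. n i)"
      by (simp add: vec_eq_iff ivec_def)
    then show ?thesis using per by simp
  qed
  then have g: "g (?\<psi> \<phi>) = f \<phi>" if "\<phi> \<in> cube" for \<phi>
    using that f_inv_into_f[of "?\<psi> \<phi>" ?\<psi> cube] unfolding g_def o_def by blast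
  have compact: "compact (?\<psi> ` cube)"
    by (intro compact_continuous_image \<psi> compact_cbox)
  have "closed (g -` C \<inter> ?\<psi> ` cube)" if "closed C" for C
  proof -
    have "g -` C \<inter> ?\<psi> ` cube = ?\<psi> ` (f -` C \<inter> cube)"
      using g by auto
    moreover have "compact (f -` C \<inter> cube)"
      by (intro closed_Int_compact closed_vimage[OF that f] compact_cbox)
    ultimately show ?thesis
      by (simp add: compact_continuous_image \<psi> compact_imp_closed)
  qed
  then have "continuous_on (?\<psi> ` cube) g"
    using continuous_on_closed_vimage[OF compact_imp_closed[OF compact]] by blast
  then obtain q where q: "real_polynomial_function q" "\<And>z. z \<in> ?\<psi> ` cube \<Longrightarrow> \<bar>g z - q z\<bar> < \<epsilon>"
    using Stone_Weierstrass_real_polynomial_function[OF compact _ \<open>0 < \<epsilon>\<close>] by blast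
  show ?thesis
  proof (rule that[OF q(1)])
    fix \<phi> :: "real^'m" assume "\<phi> \<in> cube"
    then show "\<bar>f \<phi> - q (?\<psi> \<phi>)\<bar> < \<epsilon>"
      using q(2)[OF imageI[of \<phi> cube ?\<psi>]] g[of \<phi>] by simp
  qed
qed

text \<open>As \<open>f\<close> is orthogonal to every q(psi), the integral of f^2 equals that of (f
  - q) f, hence is at most epsilon times the integral of |f|. So it is 0, and continuity and
  periodicity give f = 0 everywhere.\<close>

lemma fourier_integral_eq_0_imp_eq_0:
  fixes f :: "real^'m \<Rightarrow> real"
  assumes f: "continuous_on UNIV f" and per: "\<And>\<phi> k. f (\<phi> + (2 * pi) *\<^sub>R ivec k) = f \<phi>"
    and zero: "\<And>k. fourier_integral (\<lambda>\<phi>. of_real (f \<phi>)) k = 0"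
  shows "f \<phi> = 0"
proof -
  have int: "h integrable_on cube" if "continuous_on UNIV h" for h :: "real^'m \<Rightarrow> real"
    using that by (intro integrable_continuous) (auto intro: continuous_on_subset)
  let ?I = "integral cube (\<lambda>\<phi>. f \<phi> * f \<phi>)" and ?A = "integral cube (\<lambda>\<phi>. \<bar>f \<phi>\<bar>)"
  have le: "?I \<le> \<epsilon> * ?A" if "\<epsilon> > 0" for \<epsilon>
  proof -
    obtain q :: "complex^'m \<Rightarrow> real" where q: "real_polynomial_function q"
      "\<And>\<phi>. \<phi> \<in> cube \<Longrightarrow> \<bar>f \<phi> - q (\<chi> i. cis (\<phi> $ i))\<bar> < \<epsilon>"
      using trigonometric_approximation[OF f per \<open>\<epsilon> > 0\<close>] by metis
    let ?q = "\<lambda>\<phi>. q (\<chi> i. cis (\<phi> $ i))"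
    have cont_q: "continuous_on UNIV ?q"
      by (intro continuous_on_compose2[OF
        continuous_on_polymonial_function[OF q(1)[unfolded real_polynomial_function_eq], of UNIV]] continuous_intros) auto
    have "complex_of_real (integral cube (\<lambda>\<phi>. ?q \<phi> * f \<phi>)) = integral cube (\<lambda>\<phi>. complex_of_real (?q \<phi> * f \<phi>))"
      by (rule integral_unique[OF has_integral_of_real[OF integrable_integral[OF
              int[OF continuous_on_mult[OF cont_q f]]]], symmetric])
    also have "\<dots> = 0"
      using fourier_integral_polynomial_eq_0[OF q(1) _ zero, of 0] f
      by (simp add: fourier_integral_def ivec_zero continuous_on_of_real)
    finally have "integral cube (\<lambda>\<phi>. ?q \<phi> * f \<phi>) = 0"
      by simp
    then have "?I = integral cube (\<lambda>\<phi>. f \<phi> * f \<phi> - ?q \<phi> * f \<phi>)"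
      by (subst integral_diff) (auto intro!: int continuous_intros f cont_q)
    also have "\<dots> \<le> integral cube (\<lambda>\<phi>. \<epsilon> * \<bar>f \<phi>\<bar>)"
    proof (rule integral_le)
      fix \<phi> :: "real^'m" assume "\<phi> \<in> cube"
      then have "(f \<phi> - ?q \<phi>) * f \<phi> \<le> \<epsilon> * \<bar>f \<phi>\<bar>"
        using q(2) abs_le_D1[of "(f \<phi> - ?q \<phi>) * f \<phi>"]
        by (metis abs_ge_zero abs_mult less_imp_le mult_right_mono)
      then show "f \<phi> * f \<phi> - ?q \<phi> * f \<phi> \<le> \<epsilon> * \<bar>f \<phi>\<bar>"
        by (simp add: algebra_simps)
    qed (auto intro!: int continuous_intros f cont_q)
    finally show ?thesis by simp
  qed
  have "?I \<le> 0"
  proof (rule field_le_epsilon)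
    fix e :: real assume "e > 0"
    have "?A \<ge> 0" by (rule integral_nonneg) (auto intro!: int continuous_intros f)
    with \<open>e > 0\<close> le[of "e / (?A + 1)"] have "?I \<le> e / (?A + 1) * ?A" by simp
    also have "\<dots> \<le> e" using \<open>?A \<ge> 0\<close> \<open>e > 0\<close> by (simp add: field_simps)
    finally show "?I \<le> 0 + e" by simp
  qed
  moreover have "?I \<ge> 0"
    by (rule integral_nonneg) (auto intro!: int continuous_intros f)
  ultimately have "?I = 0" by simp
  moreover have "box 0 (\<chi> l::'m. 2 * pi) \<noteq> {}"
    by (simp add: interval_ne_empty_cart)
  ultimately have zero_cube: "f \<theta> = 0" if "\<theta> \<in> cube" for \<theta>
    using integral_cbox_eq_0_iff[OF continuous_on_subset[OF continuous_on_mult[OF f f] subset_UNIV], of 0 "\<chi> l. 2 * pi"] that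
    by simp
  show ?thesis
    using exists_translate_in_cube[of \<phi>] zero_cube per by metis
qed

section \<open>Coefficients of real vector-valued torus maps\<close>

lemma fcoeff_nth:
  "fcoeff (A :: real^'m::finite \<Rightarrow> real^'d::finite) k $ i =
    of_real (1 / (2 * pi) ^ CARD('m)) * fourier_integral (\<lambda>\<phi>. of_real (A \<phi> $ i)) k"
  by (simp add: fcoeff_def fourier_integral_def)

lemma torus_smooth_of_real_nth:
  "torus_smooth A \<Longrightarrow> torus_smooth (\<lambda>\<phi>. complex_of_real (A \<phi> $ i))"
  by (intro torus_smooth_bounded_linear[OF bounded_linear_of_real] torus_smooth_vec_nth)

lemma continuous_of_real_nth:
  fixes A :: "real^'m::finite \<Rightarrow> real^'d::finite"
  shows "torus_smooth A \<Longrightarrow> continuous_on UNIV (\<lambda>\<phi>. complex_of_real (A \<phi> $ i))"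
  by (intro smooth_continuous_on torus_smooth_smooth torus_smooth_of_real_nth)

lemma fcoeff_add:
  assumes "torus_smooth A" "torus_smooth B"
  shows "fcoeff (\<lambda>\<phi>. A \<phi> + B \<phi>) k = fcoeff A k + fcoeff B k"
  by (simp add: vec_eq_iff fcoeff_nth fourier_integral_add[OF continuous_of_real_nth[OF assms(1)]
        continuous_of_real_nth[OF assms(2)]] distrib_left)

lemma fcoeff_dderiv:
  assumes "torus_smooth A"
  shows "fcoeff (dderiv \<omega> A) k = (\<i> * complex_of_real (\<omega> \<bullet> ivec k)) *s fcoeff A k"
proof -
  have "complex_of_real (dderiv \<omega> A \<phi> $ i) = dderiv \<omega> (\<lambda>\<phi>. complex_of_real (A \<phi> $ i)) \<phi>" for \<phi> i
    by (simp add: dderiv_vec_nth[OF assms] dderiv_bounded_linear[OF bounded_linear_of_real torus_smooth_vec_nth[OF assms]])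
  then show ?thesis
    by (simp add: vec_eq_iff fcoeff_nth fourier_integral_dderiv[OF torus_smooth_of_real_nth[OF assms], symmetric])
qed

lemma fcoeff_matrix:
  fixes L :: "real^'d^'e" and A :: "real^'m \<Rightarrow> real^'d"
  assumes "torus_smooth A"
  shows "fcoeff (\<lambda>\<phi>. L *v A \<phi>) k = cmat L *v fcoeff A k"
proof -
  have "fourier_integral (\<lambda>\<phi>. \<Sum>j\<in>UNIV. complex_of_real (L $ i $ j) * complex_of_real (A \<phi> $ j)) k =
      (\<Sum>j\<in>UNIV. complex_of_real (L $ i $ j) * fourier_integral (\<lambda>\<phi>. complex_of_real (A \<phi> $ j)) k)" for i
    by (subst fourier_integral_sum)
      (auto simp: fourier_integral_mult intro!: continuous_on_mult_left continuous_of_real_nth assms)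
  then show ?thesis
    by (simp add: vec_eq_iff fcoeff_nth matrix_vector_mult_def cmat_def map_matrix_def sum_distrib_left ac_simps)
qed

lemma fcoeff_eqI:
  fixes A B :: "real^'m \<Rightarrow> real^'d"
  assumes A: "torus_smooth A" and B: "torus_smooth B" and eq: "\<And>k. fcoeff A k = fcoeff B k"
  shows "A \<phi> = B \<phi>"
proof -
  have diff: "torus_smooth (\<lambda>\<phi>. A \<phi> - B \<phi>)"
    by (rule torus_smooth_diff[OF A B])
  have "fcoeff (\<lambda>\<phi>. A \<phi> - B \<phi>) k = 0" for k
    using fcoeff_add[OF diff B, of k] eq by simp
  then have "fourier_integral (\<lambda>\<phi>. of_real ((A \<phi> - B \<phi>) $ i)) k = 0" for i k
    using fcoeff_nth[of "\<lambda>\<phi>. A \<phi> - B \<phi>" k i] by simp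
  then have "(A \<phi> - B \<phi>) $ i = 0" for i
    using torus_smooth_vec_nth[OF diff, of i]
    by (intro fourier_integral_eq_0_imp_eq_0[where f="\<lambda>\<phi>. (A \<phi> - B \<phi>) $ i"])
      (auto simp: torus_smooth_def intro: smooth_continuous_on)
  then show ?thesis by (simp add: vec_eq_iff)
qed

lemma fcoeff_eq_iff:
  fixes A B :: "real^'m::finite \<Rightarrow> real^'d::finite"
  assumes "torus_smooth A" "torus_smooth B"
  shows "(\<forall>\<phi>. A \<phi> = B \<phi>) \<longleftrightarrow> (\<forall>k. fcoeff A k = fcoeff B k)"
proof
  assume "\<forall>\<phi>. A \<phi> = B \<phi>"
  then have "A = B" by blast
  then show "\<forall>k. fcoeff A k = fcoeff B k" by simp
qed (use fcoeff_eqI[OF assms] in blast)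

lemma fcoeff_uminus: "fcoeff A (- k) $ i = cnj (fcoeff A k $ i)"
  by (simp add: fcoeff_def integral_cnj ivec_minus cis_cnj)

text \<open>Symmetry of \<open>S\<close> and conjugate symmetry of \<open>c\<close> make the finite
  sum invariant under conjugation, hence real; taking \<open>Re\<close> in the definition of
  \<open>g\<close> therefore leaves the coefficients intact.\<close>

lemma exists_trigonometric_polynomial:
  fixes c :: "int^'m \<Rightarrow> complex^'d"
  assumes S: "finite S" "uminus ` S = S" and c: "\<And>k i. c (- k) $ i = cnj (c k $ i)"
  obtains g :: "real^'m \<Rightarrow> real^'d"
  where "torus_smooth g" "\<And>k. fcoeff g k = (if k \<in> S then c k else 0)"
proof -
  let ?z = "\<lambda>i \<phi>. \<Sum>k\<in>S. c k $ i * cis (ivec k \<bullet> \<phi>)"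
  define g where "g \<phi> = (\<chi> i. Re (?z i \<phi>))" for \<phi>
  have cis: "torus_smooth (\<lambda>\<phi>. a * cis (ivec k \<bullet> \<phi>))" for a k
    by (rule torus_smooth_bounded_linear[OF bounded_linear_mult_right torus_smooth_cis])
  have g: "torus_smooth g"
    unfolding g_def
    by (rule torus_smooth_cart) (simp only: vec_lambda_beta, intro torus_smooth_bounded_linear[OF bounded_linear_Re] torus_smooth_sum cis)
  have self_conjugate: "complex_of_real (Re z) = z" if "cnj z = z" for z
    using that by (simp add: complex_eq_iff)
  have "cnj (?z i \<phi>) = ?z i \<phi>" for i \<phi>
  proof -
    have "cnj (?z i \<phi>) = (\<Sum>k\<in>S. c (- k) $ i * cis (ivec (- k) \<bullet> \<phi>))"
      by (simp add: c ivec_minus cis_cnj)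
    also have "\<dots> = (\<Sum>k\<in>uminus ` S. c k $ i * cis (ivec k \<bullet> \<phi>))"
      by (subst sum.reindex) auto
    finally show ?thesis by (simp only: S(2))
  qed
  then have "complex_of_real (g \<phi> $ i) = ?z i \<phi>" for \<phi> i
    using self_conjugate by (simp only: g_def vec_lambda_beta)
  then have "fcoeff g k $ i = of_real (1 / (2 * pi) ^ CARD('m)) *
      (\<Sum>l\<in>S. c l $ i * fourier_integral (\<lambda>\<phi>. cis (ivec l \<bullet> \<phi>)) k)" for k i
    by (simp add: fcoeff_nth fourier_integral_sum[OF smooth_continuous_on[OF torus_smooth_smooth[OF cis]]]
        fourier_integral_mult)
  then have "fcoeff g k $ i = (if k \<in> S then c k $ i else 0)" for k i
    using S(1) by (simp add: fourier_integral_cis if_distrib cong: if_cong)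
  then have "fcoeff g k = (if k \<in> S then c k else 0)" for k
    by (simp add: vec_eq_iff[of "fcoeff g k"])
  with g show ?thesis by (rule that)
qed

lemma finite_ivec_ball: "finite {k :: int^'m::finite. norm (ivec k) \<le> r}"
proof (rule finite_subset)
  show "{k :: int^'m. norm (ivec k) \<le> r} \<subseteq> vec_lambda ` (UNIV \<rightarrow>\<^sub>E {- \<lceil>r\<rceil>..\<lceil>r\<rceil>})"
  proof
    fix k :: "int^'m" assume "k \<in> {k. norm (ivec k) \<le> r}"
    then have "\<bar>real_of_int (k $ i)\<bar> \<le> r" for i
      using component_le_norm_cart[of "ivec k" i] by (simp add: ivec_def)
    then have "\<bar>k $ i\<bar> \<le> \<lceil>r\<rceil>" for i
      by (metis ceiling_mono ceiling_of_int of_int_abs)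
    then have "vec_nth k \<in> UNIV \<rightarrow>\<^sub>E {- \<lceil>r\<rceil>..\<lceil>r\<rceil>}"
      by (auto simp: abs_le_iff) (metis minus_le_iff)
    then show "k \<in> vec_lambda ` (UNIV \<rightarrow>\<^sub>E {- \<lceil>r\<rceil>..\<lceil>r\<rceil>})"
      by (metis image_eqI vec_nth_inverse)
  qed
  show "finite (vec_lambda ` (UNIV \<rightarrow>\<^sub>E {- \<lceil>r\<rceil>..\<lceil>r\<rceil>}) :: (int^'m) set)"
    by (intro finite_imageI finite_PiE) auto
qed

text \<open>A nonzero kernel vector would be an eigenvector of \<open>L\<close> for the imaginary
  number i<omega,k>.\<close>

lemma resolvent_invertible:
  assumes "hyperbolic_matrix L" shows "invertible (resolvent_mat \<omega> L k)"
proof (rule invertible_if_injective)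
  fix x :: "complex^'a" assume "resolvent_mat \<omega> L k *v x = 0"
  then have "cmat L *v x = (\<i> * complex_of_real (\<omega> \<bullet> ivec k)) *s x"
    by (simp add: resolvent_mat_def matrix_vector_mult_diff_rdistrib mat_matrix_vector)
  then show "x = 0"
    using assms unfolding hyperbolic_matrix_def by fastforce
qed

section \<open>The linearised equation in tangential and normal components\<close>

lemmas torus_smooth_scaleR = torus_smooth_bounded_bilinear[OF bounded_bilinear_scaleR]
lemmas torus_smooth_mult = torus_smooth_bounded_bilinear[OF bounded_bilinear_mult]

lemma torus_smooth_inverse:
  fixes f :: "real^'m::finite \<Rightarrow> real"
  shows "(\<And>\<phi>. f \<phi> \<noteq> 0) \<Longrightarrow> torus_smooth f \<Longrightarrow> torus_smooth (\<lambda>\<phi>. inverse (f \<phi>))"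
  by (simp add: torus_smooth_def smooth_inverse)

lemma torus_smooth_prod:
  fixes f :: "'i \<Rightarrow> real^'m::finite \<Rightarrow> real"
  shows "(\<And>i. i \<in> I \<Longrightarrow> torus_smooth (f i)) \<Longrightarrow> torus_smooth (\<lambda>\<phi>. \<Prod>i\<in>I. f i \<phi>)"
  by (simp add: torus_smooth_def smooth_prod)

lemma torus_smooth_det:
  fixes A :: "real^'m::finite \<Rightarrow> real^'k::finite^'k"
  assumes "\<And>i j. torus_smooth (\<lambda>\<phi>. A \<phi> $ i $ j)"
  shows "torus_smooth (\<lambda>\<phi>. det (A \<phi>))"
  unfolding det_def by (intro torus_smooth_sum torus_smooth_mult torus_smooth_const torus_smooth_prod assms)

text \<open>Cramer's rule: each component of the solution is a quotient of determinants with smooth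
  entries, and the denominator has no zeros.\<close>

lemma torus_smooth_linear_system:
  fixes A :: "real^'m::finite \<Rightarrow> real^'k::finite^'k"
  assumes A: "\<And>i j. torus_smooth (\<lambda>\<phi>. A \<phi> $ i $ j)" and det: "\<And>\<phi>. det (A \<phi>) \<noteq> 0"
    and b: "\<And>i. torus_smooth (\<lambda>\<phi>. b \<phi> $ i)" and x: "\<And>\<phi>. A \<phi> *v x \<phi> = b \<phi>"
  shows "torus_smooth x"
proof (rule torus_smooth_cart)
  fix k
  have "torus_smooth (\<lambda>\<phi>. if j = k then b \<phi> $ i else A \<phi> $ i $ j)" for i j
    by (cases "j = k") (simp_all add: A b)
  then have "torus_smooth (\<lambda>\<phi>. det (\<chi> i j. if j = k then b \<phi> $ i else A \<phi> $ i $ j))"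
    by (intro torus_smooth_det) simp
  then have "torus_smooth (\<lambda>\<phi>. det (\<chi> i j. if j = k then b \<phi> $ i else A \<phi> $ i $ j) * inverse (det (A \<phi>)))"
    by (rule torus_smooth_mult[OF _ torus_smooth_inverse[OF det torus_smooth_det[OF A]]])
  moreover have "x \<phi> $ k = det (\<chi> i j. if j = k then b \<phi> $ i else A \<phi> $ i $ j) * inverse (det (A \<phi>))" for \<phi>
    using cramer[OF det, THEN iffD1, OF x, of \<phi>] by (simp add: vec_eq_iff divide_inverse)
  ultimately show "torus_smooth (\<lambda>\<phi>. x \<phi> $ k)" by simp
qed

lemma bounded_bilinear_matrix_vector: "bounded_bilinear ((*v) :: real^'a::finite^'b::finite \<Rightarrow> _)"
  by (intro bilinear_conv_bounded_bilinear[THEN iffD1] bilinear_def[THEN iffD2] conjI allI linearI)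
    (auto simp: matrix_vector_right_distrib matrix_vector_mult_add_rdistrib vec_eq_iff matrix_vector_mult_def
      sum_distrib_left sum.distrib algebra_simps)

lemma matrix_inv_left: "invertible A \<Longrightarrow> matrix_inv A ** A = mat 1"
  and matrix_inv_right: "invertible A \<Longrightarrow> A ** matrix_inv A = mat 1"
  unfolding matrix_inv_def invertible_def by (metis (mono_tags, lifting) someI_ex)+

lemma invertible_gram:
  fixes A :: "real^'k::finite^'l::finite"
  assumes "inj ((*v) A)" shows "invertible (transpose A ** A)"
proof (rule invertible_if_injective)
  fix x assume "(transpose A ** A) *v x = 0"
  then have "(A *v x) \<bullet> (A *v x) = 0"
    by (metis dot_lmul_matrix inner_zero_right matrix_vector_mul_assoc vector_transpose_matrix transpose_transpose)
  then show "x = 0"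
    using assms by (metis inj_eq inner_eq_zero_iff matrix_vector_mult_0_right)
qed

lemma pinv_apply:
  fixes A :: "real^'k::finite^'l::finite"
  assumes "inj ((*v) A)" shows "pinv A *v (A *v x) = x"
  by (simp add: pinv_def matrix_vector_mul_assoc matrix_mul_assoc[symmetric]
      matrix_inv_left[OF invertible_gram[OF assms]])

text \<open>The curve is exp(tL) u0, built as a power series in each component and dominated by an
  exponential series. It is needed because reducibility is stated through solution curves.\<close>

lemma linear_ode_solution:
  fixes L :: "real^'n::finite^'n" and u0 :: "real^'n"
  obtains u where "u 0 = u0" "\<And>t. (u has_vector_derivative L *v u t) (at t)"
proof -
  define c where "c i n = (((*v) L ^^ n) u0 $ i) / fact n" for i n
  obtain B where B: "\<And>x. norm (L *v x) \<le> norm x * B" "B > 0"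
    using bounded_linear.pos_bounded[OF matrix_vector_mul_bounded_linear[of L]] by auto
  have norm_pow: "norm (((*v) L ^^ n) u0) \<le> norm u0 * B ^ n" for n
  proof (induction n)
    case (Suc n)
    have "norm (((*v) L ^^ Suc n) u0) \<le> norm (((*v) L ^^ n) u0) * B"
      by (simp add: B)
    also have "\<dots> \<le> (norm u0 * B ^ n) * B"
      using Suc B by (intro mult_right_mono) auto
    finally show ?case by (simp add: ac_simps)
  qed simp
  have summable: "summable (\<lambda>n. c i n * t ^ n)" for i t
  proof (rule summable_comparison_test)
    have "norm (c i n * t ^ n) \<le> norm u0 * (inverse (fact n) * (B * \<bar>t\<bar>) ^ n)" for n
    proof -
      have "\<bar>((*v) L ^^ n) u0 $ i\<bar> \<le> norm u0 * B ^ n"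
        using component_le_norm_cart norm_pow order_trans by blast
      then have "\<bar>((*v) L ^^ n) u0 $ i\<bar> * (\<bar>t\<bar> ^ n * inverse (fact n)) \<le> norm u0 * B ^ n * (\<bar>t\<bar> ^ n * inverse (fact n))"
        by (intro mult_right_mono) auto
      then show ?thesis
        by (simp add: c_def abs_mult power_abs power_mult_distrib field_simps)
    qed
    then show "\<exists>N. \<forall>n\<ge>N. norm (c i n * t ^ n) \<le> norm u0 * (inverse (fact n) * (B * \<bar>t\<bar>) ^ n)"
      by blast
    show "summable (\<lambda>n. norm u0 * (inverse (fact n) * (B * \<bar>t\<bar>) ^ n))"
      by (intro summable_mult summable_exp)
  qed
  define u where "u t = (\<chi> i. \<Sum>n. c i n * t ^ n)" for t
  have diffs_c: "diffs (c i) n = (\<Sum>j\<in>UNIV. L $ i $ j * c j n)" for i n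
  proof -
    have "diffs (c i) n = (((*v) L ^^ Suc n) u0 $ i) / fact n"
      by (simp add: diffs_def c_def divide_simps)
    also have "\<dots> = (\<Sum>j\<in>UNIV. L $ i $ j * c j n)"
      by (simp add: matrix_vector_mult_def c_def sum_divide_distrib)
    finally show ?thesis .
  qed
  have der: "((\<lambda>t. u t $ i) has_real_derivative (L *v u t) $ i) (at t)" for i t
  proof -
    have "(\<Sum>n. diffs (c i) n * t ^ n) = (\<Sum>n. \<Sum>j\<in>UNIV. L $ i $ j * (c j n * t ^ n))"
      by (simp add: diffs_c sum_distrib_right mult.assoc)
    also have "\<dots> = (\<Sum>j\<in>UNIV. \<Sum>n. L $ i $ j * (c j n * t ^ n))"
      by (rule suminf_sum) (intro summable_mult summable)
    also have "\<dots> = (L *v u t) $ i"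
      by (simp add: matrix_vector_mult_def u_def suminf_mult[OF summable])
    finally show ?thesis
      using termdiffs_strong_converges_everywhere[OF summable, of i t] by (simp add: u_def)
  qed
  have "(u has_vector_derivative L *v u t) (at t)" for t
    unfolding has_vector_derivative_def
    by (subst has_derivative_componentwise_within)
      (auto simp: Basis_vec_def inner_axis intro!: der[unfolded has_field_derivative_def, THEN has_derivative_eq_rhs])
  moreover have "u 0 = u0"
    by (simp only: u_def powser_zero) (simp add: vec_eq_iff c_def)
  ultimately show ?thesis using that by blast
qed

section \<open>The splitting along the torus and the linearised equation\<close>

locale reducible_torus =
  fixes F0 :: "real^'M::finite \<Rightarrow> real^'M" and \<omega> :: "real^'m::finite"
    and e0 :: "real^'m \<Rightarrow> real^'M" and N :: "real^'m \<Rightarrow> real^'n::finite^'M" and L :: "real^'n^'n"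
  assumes dim: "CARD('M) = CARD('m) + CARD('n)"
    and F0_smooth: "smooth F0"
    and torus: "invariant_torus F0 \<omega> e0"
    and reducible: "reducible_by F0 \<omega> e0 N L"
begin

lemma e0_smooth: "torus_smooth e0"
  and N_smooth: "torus_smooth N"
  and dderiv_e0: "dderiv \<omega> e0 = (\<lambda>\<phi>. F0 (e0 \<phi>))"
  using torus reducible by (auto simp: invariant_torus_def torus_embedding_def reducible_by_def)

abbreviation J :: "real^'m \<Rightarrow> real^'m^'M" where
  "J \<phi> \<equiv> jacobian e0 (at \<phi>)"

lemma J_apply: "J \<phi> *v u = frechet_derivative e0 (at \<phi>) u"
  unfolding jacobian_def
  using matrix_vector_mul(2)[OF smooth_linear[OF torus_smooth_smooth[OF e0_smooth]], of \<phi>] by metis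

lemma J_smooth: "torus_smooth J"
proof (intro torus_smooth_cart)
  fix i j
  have "torus_smooth (\<lambda>\<phi>. frechet_derivative e0 (at \<phi>) (axis j 1) $ i)"
    by (intro torus_smooth_vec_nth torus_smooth_frechet_derivative e0_smooth)
  moreover have "J \<phi> $ i $ j = frechet_derivative e0 (at \<phi>) (axis j 1) $ i" for \<phi>
    by (simp add: jacobian_def matrix_def)
  ultimately show "torus_smooth (\<lambda>\<phi>. J \<phi> $ i $ j)" by simp
qed

lemma splitting_exists: "\<exists>u v. x = J \<phi> *v u + N \<phi> *v v"
proof -
  have "x \<in> {x + y | x y. x \<in> range (frechet_derivative e0 (at \<phi>)) \<and> y \<in> range ((*v) (N \<phi>))}"
    using reducible by (simp add: reducible_by_def)
  then show ?thesis by (auto simp: J_apply)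
qed

text \<open>The tangent and normal ranges span the space; since the dimensions add up, surjectivity
  of the sum map yields injectivity, and with it that of \<open>J\<close> and \<open>N\<close>
  separately.\<close>

lemma splitting_inj: "inj (\<lambda>(u, v). J \<phi> *v u + N \<phi> *v v)"
proof (rule linear_surjective_imp_injective)
  show "linear (\<lambda>(u, v). J \<phi> *v u + N \<phi> *v v)"
    by (rule linearI)
      (auto simp: matrix_vector_right_distrib matrix_vector_mult_scaleR scaleR_add_right)
  show "surj (\<lambda>(u, v). J \<phi> *v u + N \<phi> *v v)"
    using splitting_exists by (force simp: surj_def)
qed (simp add: dim)

lemma splitting_unique:
  assumes "J \<phi> *v u + N \<phi> *v v = J \<phi> *v u' + N \<phi> *v v'"
  shows "u = u' \<and> v = v'"
  using injD[OF splitting_inj, of \<phi> "(u, v)" "(u', v')"] assms by simp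

lemma inj_J: "inj ((*v) (J \<phi>))"
  and inj_N: "inj ((*v) (N \<phi>))"
  using splitting_unique[of \<phi> _ 0 _ 0] splitting_unique[of \<phi> 0 _ 0] by (auto simp: inj_def)

text \<open>The matrix (J | N). Rows and columns are indexed by different types, so
  \<open>det\<close> does not apply to it; its Gram matrix is square and takes its place.\<close>

definition block :: "real^'m \<Rightarrow> real^('m + 'n)^'M" where
  "block \<phi> = (\<chi> i j. case j of Inl a \<Rightarrow> J \<phi> $ i $ a | Inr b \<Rightarrow> N \<phi> $ i $ b)"

lemma block_apply: "block \<phi> *v x = J \<phi> *v (\<chi> a. x $ Inl a) + N \<phi> *v (\<chi> b. x $ Inr b)"
  by (simp add: vec_eq_iff block_def matrix_vector_mult_def UNIV_Plus_UNIV[symmetric] sum.Plus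
      del: UNIV_Plus_UNIV)

lemma inj_block: "inj ((*v) (block \<phi>))"
proof (rule injI)
  fix x y assume "block \<phi> *v x = block \<phi> *v y"
  then have "(\<chi> a. x $ Inl a) = (\<chi> a. y $ Inl a) \<and> (\<chi> b. x $ Inr b) = (\<chi> b. y $ Inr b)"
    unfolding block_apply by (rule splitting_unique)
  then show "x = y"
    by (auto simp: vec_eq_iff) (metis sum.exhaust)
qed

lemma torus_smooth_block: "torus_smooth (\<lambda>\<phi>. block \<phi> $ i $ j)"
  by (cases j) (simp_all add: block_def torus_smooth_vec_nth J_smooth N_smooth)

text \<open>The components are first picked pointwise, without any regularity. They solve the normal
  equations of \<open>block\<close>, whose matrix is smooth and invertible, so they are
  smooth.\<close>

lemma split_exists:
  assumes a: "torus_smooth a" obtains g h where "splits e0 N a g h"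
proof -
  have "\<forall>\<phi>. \<exists>u v. a \<phi> = J \<phi> *v u + N \<phi> *v v"
    using splitting_exists by blast
  then obtain g h where gh: "\<And>\<phi>. a \<phi> = J \<phi> *v g \<phi> + N \<phi> *v h \<phi>"
    by metis
  define x where "x \<phi> = (\<chi> j. case j of Inl k \<Rightarrow> g \<phi> $ k | Inr k \<Rightarrow> h \<phi> $ k)" for \<phi>
  have "block \<phi> *v x \<phi> = a \<phi>" for \<phi>
    by (simp add: block_apply x_def gh)
  then have "(transpose (block \<phi>) ** block \<phi>) *v x \<phi> = transpose (block \<phi>) *v a \<phi>" for \<phi>
    by (simp add: matrix_vector_mul_assoc[symmetric])
  then have "torus_smooth x"
  proof (rule torus_smooth_linear_system[rotated 3])
    show "det (transpose (block \<phi>) ** block \<phi>) \<noteq> 0" for \<phi>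
      using invertible_gram[OF inj_block] by (simp add: invertible_det_nz)
    show "torus_smooth (\<lambda>\<phi>. (transpose (block \<phi>) ** block \<phi>) $ i $ j)" for i j
      by (simp add: matrix_matrix_mult_def transpose_def)
        (intro torus_smooth_sum torus_smooth_mult torus_smooth_block)
    show "torus_smooth (\<lambda>\<phi>. (transpose (block \<phi>) *v a \<phi>) $ i)" for i
      by (simp add: matrix_vector_mult_def transpose_def)
        (intro torus_smooth_sum torus_smooth_mult torus_smooth_block torus_smooth_vec_nth a)
  qed
  then have "torus_smooth g" "torus_smooth h"
    using torus_smooth_vec_nth[of x "Inl _"] torus_smooth_vec_nth[of x "Inr _"]
    by (auto simp: x_def intro!: torus_smooth_cart)
  then show ?thesis
    using that gh by (auto simp: splits_def J_apply)
qed

lemma splits_apply: "splits e0 N a g h \<Longrightarrow> a \<phi> = J \<phi> *v g \<phi> + N \<phi> *v h \<phi>"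
  by (simp add: splits_def J_apply)

lemma splits_unique: "splits e0 N a g h \<Longrightarrow> splits e0 N a g' h' \<Longrightarrow> g = g' \<and> h = h'"
  using splits_apply[of a g h] splits_apply[of a g' h'] splitting_unique by (metis ext)

lemma splits_smooth: "splits e0 N a g h \<Longrightarrow> torus_smooth a"
proof -
  assume "splits e0 N a g h"
  then have gh: "torus_smooth g" "torus_smooth h" and "a = (\<lambda>\<phi>. J \<phi> *v g \<phi> + N \<phi> *v h \<phi>)"
    by (auto simp: splits_def J_apply fun_eq_iff)
  then show "torus_smooth a"
    by (simp add: torus_smooth_add torus_smooth_bounded_bilinear[OF bounded_bilinear_matrix_vector] J_smooth N_smooth)
qed

text \<open>The omega- and u-derivatives of \<open>e0\<close> have to be interchanged before the
  invariance equation can be differentiated along u.\<close>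

lemma dderiv_J: "dderiv \<omega> J \<phi> *v u = frechet_derivative F0 (at (e0 \<phi>)) (J \<phi> *v u)"
proof -
  have "dderiv \<omega> J \<phi> *v u = dderiv \<omega> (\<lambda>\<phi>. J \<phi> *v u) \<phi>"
    using dderiv_bounded_bilinear[OF bounded_bilinear_matrix_vector J_smooth torus_smooth_const, of \<omega> u \<phi>]
    by (simp add: dderiv_eqI[OF has_derivative_const])
  also have "\<dots> = dderiv \<omega> (dderiv u e0) \<phi>"
    by (simp add: J_apply dderiv_def[of u e0, abs_def])
  also have "\<dots> = dderiv u (\<lambda>\<phi>. F0 (e0 \<phi>)) \<phi>"
    by (simp add: dderiv_commute[OF e0_smooth, of \<omega> u] dderiv_e0)
  also have "\<dots> = frechet_derivative F0 (at (e0 \<phi>)) (J \<phi> *v u)"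
    using dderiv_eqI[OF has_derivative_compose[OF torus_smooth_has_derivative[OF e0_smooth]
        smooth_has_derivative[OF F0_smooth]]] by (simp add: J_apply)
  finally show ?thesis .
qed

text \<open>Test reducibility on the solution curve through (phi, u0) and compare, at time 0, the
  velocity it prescribes with the one given by the product rule.\<close>

lemma dderiv_N: "dderiv \<omega> N \<phi> *v u0 + N \<phi> *v (L *v u0) = frechet_derivative F0 (at (e0 \<phi>)) (N \<phi> *v u0)"
proof -
  obtain u where u: "u 0 = u0" "\<And>t. (u has_vector_derivative L *v u t) (at t)"
    using linear_ode_solution by metis
  let ?\<phi> = "\<lambda>t. \<phi> + t *\<^sub>R \<omega>"
  have "(?\<phi> has_vector_derivative \<omega>) (at t)" for t
    by (auto intro!: derivative_eq_intros)
  then have "((\<lambda>s. (e0 (?\<phi> s), N (?\<phi> s) *v u s)) has_vector_derivative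
      (F0 (e0 (?\<phi> 0)), frechet_derivative F0 (at (e0 (?\<phi> 0))) (N (?\<phi> 0) *v u 0))) (at 0)"
    using reducible u(2) unfolding reducible_by_def by blast
  then have "((\<lambda>s. N (?\<phi> s) *v u s) has_vector_derivative frechet_derivative F0 (at (e0 \<phi>)) (N \<phi> *v u0)) (at 0)"
    using bounded_linear.has_vector_derivative[OF bounded_linear_snd] by (fastforce simp: u(1))
  moreover have "((\<lambda>s. N (?\<phi> s) *v u s) has_vector_derivative
      (N (?\<phi> 0) *v (L *v u 0) + frechet_derivative N (at \<phi>) \<omega> *v u 0)) (at 0)"
    by (intro bounded_bilinear.has_vector_derivative[OF bounded_bilinear_matrix_vector] u(2)
        has_vector_derivative_along_line) (simp add: torus_smooth_has_derivative[OF N_smooth])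
  ultimately show ?thesis
    by (metis (no_types, lifting) add.commute add_0_right dderiv_def scale_zero_left u(1) vector_derivative_unique_at)
qed

lemma conj_op_split:
  assumes "splits e0 N e g h"
  shows "conj_op F0 e0 \<omega> e f \<phi> =
    J \<phi> *v (dderiv \<omega> g \<phi> + f \<phi>) + N \<phi> *v (dderiv \<omega> h \<phi> - L *v h \<phi>)"
proof -
  have gh: "torus_smooth g" "torus_smooth h" and e: "e = (\<lambda>\<phi>. J \<phi> *v g \<phi> + N \<phi> *v h \<phi>)"
    using assms by (auto simp: splits_def J_apply fun_eq_iff)
  let ?F = "frechet_derivative F0 (at (e0 \<phi>))"
  note mv = bounded_bilinear_matrix_vector
  have "dderiv \<omega> e \<phi> = (J \<phi> *v dderiv \<omega> g \<phi> + dderiv \<omega> J \<phi> *v g \<phi>) + (N \<phi> *v dderiv \<omega> h \<phi> + dderiv \<omega> N \<phi> *v h \<phi>)"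
    unfolding e
    by (subst dderiv_add) (auto intro!: torus_smooth_bounded_bilinear[OF mv] J_smooth N_smooth gh
        simp: dderiv_bounded_bilinear[OF mv J_smooth gh(1)] dderiv_bounded_bilinear[OF mv N_smooth gh(2)])
  moreover have "?F (e \<phi>) = ?F (J \<phi> *v g \<phi>) + ?F (N \<phi> *v h \<phi>)"
    unfolding e by (rule linear_add[OF smooth_linear[OF F0_smooth]])
  ultimately show ?thesis
    using dderiv_N[of \<phi> "h \<phi>"]
    by (simp add: conj_op_def dderiv_J J_apply[symmetric] matrix_vector_right_distrib matrix_vector_mult_diff_distrib
        algebra_simps)
qed

text \<open>The \<open>THE\<close> in \<open>proj_along\<close> needs both halves: the matrix of x
  -> \<open>J \<phi> *v p x\<close> satisfies the conditions, and these fix a matrix on every vector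
  J u + N v, hence everywhere.\<close>

lemma proj_along_apply: "proj_along e0 N \<phi> *v (J \<phi> *v u + N \<phi> *v v) = J \<phi> *v u"
proof -
  let ?Q = "\<lambda>P. P ** P = P \<and> P ** J \<phi> = J \<phi> \<and> P ** N \<phi> = 0"
  obtain p q where pq: "\<And>x. x = J \<phi> *v p x + N \<phi> *v q x"
    using splitting_exists[of _ \<phi>] by metis
  have p: "p (J \<phi> *v u + N \<phi> *v v) = u" for u v
    using pq splitting_unique by metis
  have lin: "linear (\<lambda>x. J \<phi> *v p x)"
  proof (rule linearI)
    fix x y and c :: real
    have "J \<phi> *v (p x + p y) + N \<phi> *v (q x + q y) = (J \<phi> *v p x + N \<phi> *v q x) + (J \<phi> *v p y + N \<phi> *v q y)"
      by (simp add: matrix_vector_right_distrib)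
    also have "\<dots> = x + y"
      by (simp only: pq[symmetric])
    finally show "J \<phi> *v p (x + y) = J \<phi> *v p x + J \<phi> *v p y"
      using p by (metis matrix_vector_right_distrib)
    have "c *\<^sub>R x = J \<phi> *v (c *\<^sub>R p x) + N \<phi> *v (c *\<^sub>R q x)"
      using pq[of x] by (metis matrix_vector_mult_scaleR scaleR_add_right)
    then show "J \<phi> *v p (c *\<^sub>R x) = c *\<^sub>R (J \<phi> *v p x)"
      using p by (metis matrix_vector_mult_scaleR)
  qed
  define P where "P = matrix (\<lambda>x. J \<phi> *v p x)"
  have P: "P *v x = J \<phi> *v p x" for x
    unfolding P_def using matrix_vector_mul(2)[OF lin] by metis
  have determined: "R *v (J \<phi> *v u + N \<phi> *v v) = J \<phi> *v u" if "?Q R" for R u v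
    using that by (simp add: matrix_vector_right_distrib matrix_vector_mul_assoc)
  have "p (J \<phi> *v u) = u" for u
    using p[of u 0] by simp
  moreover have "p (N \<phi> *v v) = 0" for v
    using p[of 0 v] by simp
  ultimately have "?Q P"
    by (auto simp: matrix_eq matrix_vector_mul_assoc[symmetric] P)
  moreover have "R = P" if "?Q R" for R
    unfolding matrix_eq using determined[OF that] determined[OF \<open>?Q P\<close>] pq by metis
  ultimately have "?Q (proj_along e0 N \<phi>)"
    unfolding proj_along_def by (rule theI[of ?Q P])
  then show ?thesis by (rule determined)
qed

text \<open>The pseudoinverses undo \<open>J\<close> and \<open>N\<close> on their ranges, so the
  defining formulas read off the two components of \<open>G_rhs\<close>.\<close>

lemma U_V_rhs_split:
  assumes "F 0 = F0" "e 0 = e0" and G: "splits e0 N (G_rhs F \<omega> e f j) U V"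
  shows "U_rhs F \<omega> N e f j = U" "V_rhs F \<omega> N e f j = V"
proof -
  have "U_rhs F \<omega> N e f j \<phi> = U \<phi>" for \<phi>
    by (simp add: U_rhs_def assms splits_apply[OF G] proj_along_apply pinv_apply[OF inj_J])
  then show "U_rhs F \<omega> N e f j = U" by blast
  have "V_rhs F \<omega> N e f j \<phi> = V \<phi>" for \<phi>
    by (simp add: V_rhs_def assms splits_apply[OF G] matrix_vector_mult_diff_rdistrib proj_along_apply
        pinv_apply[OF inj_N])
  then show "V_rhs F \<omega> N e f j = V" by blast
qed

end

section \<open>The iterative equations\<close>

lemma torus_smooth_scaleR_sum:
  "(\<And>l. l \<in> I \<Longrightarrow> torus_smooth (e l)) \<Longrightarrow> torus_smooth (\<lambda>\<psi>. \<Sum>l\<in>I. c l *\<^sub>R e l \<psi>)"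
  by (intro torus_smooth_sum torus_smooth_scaleR torus_smooth_const)

primrec iter_directional :: "'a::euclidean_space \<Rightarrow> nat \<Rightarrow> ('a \<Rightarrow> 'b::euclidean_space) \<Rightarrow> 'a \<Rightarrow> 'b" where
  "iter_directional v 0 f = f"
| "iter_directional v (Suc n) f = (\<lambda>p. frechet_derivative (iter_directional v n f) (at p) v)"

lemma smooth_iter_directional: "smooth f \<Longrightarrow> smooth (iter_directional v n f)"
  by (induction n) (auto intro: smooth_frechet_derivative)

lemma iter_deriv_along_line:
  assumes "smooth f"
  shows "iter_deriv n (\<lambda>t. f (x + t *\<^sub>R v)) = (\<lambda>t. iter_directional v n f (x + t *\<^sub>R v))"
proof (induction n)
  case 0
  show ?case by (simp add: iter_deriv_def)
next
  case (Suc n)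
  show ?case
  proof
    fix t
    have "iter_deriv (Suc n) (\<lambda>t. f (x + t *\<^sub>R v)) t =
        vector_derivative (\<lambda>t. iter_directional v n f (x + t *\<^sub>R v)) (at t)"
      using Suc by (simp add: iter_deriv_def)
    also have "\<dots> = iter_directional v (Suc n) f (x + t *\<^sub>R v)"
      by (simp, rule vector_derivative_at, rule has_vector_derivative_along_line)
        (rule smooth_has_derivative[OF smooth_iter_directional[OF assms]])
    finally show "iter_deriv (Suc n) (\<lambda>t. f (x + t *\<^sub>R v)) t = iter_directional v (Suc n) f (x + t *\<^sub>R v)" .
  qed
qed

text \<open>The bracket is a jointly smooth map \<open>H\<close> of (epsilon, phi). Its j-th
  epsilon-derivative is an iterated derivative of \<open>H\<close> in direction (1, 0), so it stays
  smooth in phi after setting epsilon = 0.\<close>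

lemma torus_smooth_G_rhs:
  fixes F :: "nat \<Rightarrow> real^'M::finite \<Rightarrow> real^'M" and \<omega> :: "real^'m::finite"
  assumes F: "\<And>i. smooth (F i)" and e: "\<And>l. l < j \<Longrightarrow> torus_smooth (e l)"
    and f: "\<And>l. 1 \<le> l \<Longrightarrow> l < j \<Longrightarrow> torus_smooth (f l)"
  shows "torus_smooth (G_rhs F \<omega> e f j)"
proof -
  define expr where "expr \<epsilon> \<phi> = (\<Sum>i\<le>j. \<epsilon> ^ i *\<^sub>R F i (\<Sum>l<j. \<epsilon> ^ l *\<^sub>R e l \<phi>))
       - frechet_derivative (\<lambda>\<psi>. \<Sum>l<j. \<epsilon> ^ l *\<^sub>R e l \<psi>) (at \<phi>)
           (\<omega> + (\<Sum>l=1..<j. \<epsilon> ^ l *\<^sub>R f l \<phi>))" for \<epsilon> \<phi>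
  define H where "H p = expr (fst p) (snd p)" for p
  have fst: "smooth (fst :: real \<times> (real^'m) \<Rightarrow> _)" and snd: "smooth (snd :: real \<times> (real^'m) \<Rightarrow> _)"
    using smooth_bounded_linear[OF bounded_linear_fst smooth_ident]
      smooth_bounded_linear[OF bounded_linear_snd smooth_ident] by auto
  have pow: "smooth (\<lambda>p :: real \<times> (real^'m). fst p ^ l)" for l
    by (rule smooth_power[OF fst])
  have series: "smooth (\<lambda>p. \<Sum>l\<in>I. fst p ^ l *\<^sub>R a l (snd p))"
    if "\<And>l. l \<in> I \<Longrightarrow> torus_smooth (a l)" for I and a :: "nat \<Rightarrow> real^'m \<Rightarrow> 'b::euclidean_space"
    by (intro smooth_sum smooth_scaleR pow smooth_compose[OF _ snd] torus_smooth_smooth that)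
  \<comment> \<open>Taking the derivative of the truncated series term by term exposes the joint
    smoothness: each term is a power of epsilon times a derivative of a fixed map.\<close>
  have "frechet_derivative (\<lambda>\<psi>. \<Sum>l<j. \<epsilon> ^ l *\<^sub>R e l \<psi>) (at \<phi>) w =
      (\<Sum>l<j. \<epsilon> ^ l *\<^sub>R frechet_derivative (e l) (at \<phi>) w)" for \<epsilon> \<phi> w
    by (subst frechet_derivative_eqI[OF has_derivative_sum[OF has_derivative_scaleR_right[OF
              torus_smooth_has_derivative[OF e]]]]) auto
  moreover have "smooth (\<lambda>p. (\<Sum>i\<le>j. fst p ^ i *\<^sub>R F i (\<Sum>l<j. fst p ^ l *\<^sub>R e l (snd p)))
       - (\<Sum>l<j. fst p ^ l *\<^sub>R frechet_derivative (e l) (at (snd p)) (\<omega> + (\<Sum>l=1..<j. fst p ^ l *\<^sub>R f l (snd p)))))"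
  proof (intro smooth_diff smooth_sum smooth_scaleR pow smooth_compose[OF F])
    show "smooth (\<lambda>p :: real \<times> (real^'m). e l (snd p))" if "l \<in> {..<j}" for l
      using that by (intro smooth_compose[OF _ snd] torus_smooth_smooth e) simp
    show "smooth (\<lambda>p :: real \<times> (real^'m). frechet_derivative (e l) (at (snd p)) (\<omega> + (\<Sum>l=1..<j. fst p ^ l *\<^sub>R f l (snd p))))"
      if "l \<in> {..<j}" for l
      using that by (intro smooth_frechet_derivative_apply torus_smooth_smooth e snd smooth_add smooth_const series)
        (auto intro: f)
  qed
  ultimately have H: "smooth H"
    by (simp add: H_def[abs_def] expr_def)
  have G: "G_rhs F \<omega> e f j \<phi> = (1 / fact j) *\<^sub>R iter_deriv j (\<lambda>\<epsilon>. expr \<epsilon> \<phi>) 0" for \<phi>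
    by (simp add: G_rhs_def expr_def)
  have "(\<lambda>\<epsilon>. expr \<epsilon> \<phi>) = (\<lambda>\<epsilon>. H ((0, \<phi>) + \<epsilon> *\<^sub>R (1, 0)))" for \<phi>
    by (simp add: H_def)
  then have "G_rhs F \<omega> e f j = (\<lambda>\<phi>. (1 / fact j) *\<^sub>R iter_directional (1, 0) j H (0, \<phi>))"
    by (intro ext) (simp only: G iter_deriv_along_line[OF H], simp)
  moreover have "smooth (\<lambda>\<phi>. (1 / fact j) *\<^sub>R iter_directional (1, 0) j H (0, \<phi>))"
    by (intro smooth_scaleR smooth_const smooth_compose[OF smooth_iter_directional[OF H]]
        smooth_bounded_linear[OF bounded_linear_Pair[OF bounded_linear_zero bounded_linear_ident] smooth_ident])
  moreover have "G_rhs F \<omega> e f j (\<phi> + (2 * pi) *\<^sub>R ivec k) = G_rhs F \<omega> e f j \<phi>" for \<phi> k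
  proof -
    have "frechet_derivative (\<lambda>\<psi>. \<Sum>l<j. \<epsilon> ^ l *\<^sub>R e l \<psi>) (at (\<phi> + (2 * pi) *\<^sub>R ivec k)) =
        frechet_derivative (\<lambda>\<psi>. \<Sum>l<j. \<epsilon> ^ l *\<^sub>R e l \<psi>) (at \<phi>)" for \<epsilon>
      by (rule frechet_derivative_periodic[OF torus_smooth_scaleR_sum]) (simp add: e)
    then have "expr \<epsilon> (\<phi> + (2 * pi) *\<^sub>R ivec k) = expr \<epsilon> \<phi>" for \<epsilon>
      by (simp add: expr_def torus_smooth_periodic[OF e] torus_smooth_periodic[OF f])
    then show ?thesis by (simp add: G)
  qed
  ultimately show ?thesis by (simp add: torus_smooth_def)
qed

text \<open>Only orders below j enter, which is what makes the recursion over j possible.\<close>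

lemma G_rhs_cong:
  assumes e: "\<And>i. i < j \<Longrightarrow> e i = e' i" and f: "\<And>i. 1 \<le> i \<Longrightarrow> i < j \<Longrightarrow> f i = f' i"
  shows "G_rhs F \<omega> e f j = G_rhs F \<omega> e' f' j"
proof -
  have "(\<Sum>l<j. \<epsilon> ^ l *\<^sub>R e l \<phi>) = (\<Sum>l<j. \<epsilon> ^ l *\<^sub>R e' l \<phi>)" for \<epsilon> \<phi>
    by (rule sum.cong) (simp_all add: e)
  moreover have "(\<Sum>l=1..<j. \<epsilon> ^ l *\<^sub>R f l \<phi>) = (\<Sum>l=1..<j. \<epsilon> ^ l *\<^sub>R f' l \<phi>)" for \<epsilon> \<phi>
    by (rule sum.cong) (simp_all add: f)
  ultimately show ?thesis
    by (intro ext) (simp only: G_rhs_def)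
qed

lemma iter_solution_cong:
  assumes "1 \<le> j" and e: "\<And>i. i \<le> j \<Longrightarrow> e i = e' i" and f: "\<And>i. 1 \<le> i \<Longrightarrow> i \<le> j \<Longrightarrow> f i = f' i"
  shows "iter_solution F \<omega> e f j \<longleftrightarrow> iter_solution F \<omega> e' f' j"
proof -
  have "G_rhs F \<omega> e f j = G_rhs F \<omega> e' f' j"
    by (rule G_rhs_cong) (simp_all add: e f)
  then show ?thesis
    using assms by (simp add: iter_solution_def)
qed

section \<open>Order-by-order solution, uniqueness and normal form\<close>

locale hyperbolic_torus = reducible_torus "F 0" \<omega> e0 N L
  for F :: "nat \<Rightarrow> real^'M::finite \<Rightarrow> real^'M" and \<omega> :: "real^'m::finite" and e0 N
    and L :: "real^'n::finite^'n" +
  assumes F_smooth: "\<And>i. smooth (F i)" and hyperbolic: "hyperbolic_matrix L"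
begin

text \<open>Smoothness of the lower orders is all that order j requires; it is solvable whether or
  not the earlier equations hold.\<close>

definition lower_smooth :: "(nat \<Rightarrow> real^'m \<Rightarrow> real^'M) \<Rightarrow> (nat \<Rightarrow> real^'m \<Rightarrow> real^'m) \<Rightarrow> nat \<Rightarrow> bool" where
  "lower_smooth e f j \<longleftrightarrow> e 0 = e0 \<and> (\<forall>i\<in>{1..<j}. torus_smooth (e i) \<and> torus_smooth (f i))"

lemma G_rhs_splits:
  assumes "lower_smooth e f j"
  shows "splits e0 N (G_rhs F \<omega> e f j) (U_rhs F \<omega> N e f j) (V_rhs F \<omega> N e f j)"
proof -
  have "torus_smooth (e l)" if "l < j" for l
    using that assms e0_smooth by (cases l) (auto simp: lower_smooth_def)
  then have "torus_smooth (G_rhs F \<omega> e f j)"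
    using assms by (intro torus_smooth_G_rhs F_smooth) (auto simp: lower_smooth_def)
  then obtain U V where "splits e0 N (G_rhs F \<omega> e f j) U V"
    by (rule split_exists)
  with U_V_rhs_split[OF refl _ this] assms show ?thesis
    by (simp add: lower_smooth_def)
qed

lemma iter_solution_iff:
  assumes lower: "lower_smooth e f j" and s: "splits e0 N (e j) g h" and fj: "torus_smooth (f j)"
  shows "iter_solution F \<omega> e f j \<longleftrightarrow>
    (\<forall>\<phi>. dderiv \<omega> g \<phi> + f j \<phi> = U_rhs F \<omega> N e f j \<phi>) \<and>
    (\<forall>\<phi>. dderiv \<omega> h \<phi> - L *v h \<phi> = V_rhs F \<omega> N e f j \<phi>)"
proof -
  have "iter_solution F \<omega> e f j \<longleftrightarrow> (\<forall>\<phi>. conj_op (F 0) e0 \<omega> (e j) (f j) \<phi> = G_rhs F \<omega> e f j \<phi>)"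
    using lower splits_smooth[OF s] fj by (auto simp: iter_solution_def lower_smooth_def)
  also have "\<dots> \<longleftrightarrow> (\<forall>\<phi>. J \<phi> *v (dderiv \<omega> g \<phi> + f j \<phi>) + N \<phi> *v (dderiv \<omega> h \<phi> - L *v h \<phi>) =
      J \<phi> *v U_rhs F \<omega> N e f j \<phi> + N \<phi> *v V_rhs F \<omega> N e f j \<phi>)"
    by (simp only: conj_op_split[OF s] splits_apply[OF G_rhs_splits[OF lower]])
  also have "\<dots> \<longleftrightarrow> (\<forall>\<phi>. dderiv \<omega> g \<phi> + f j \<phi> = U_rhs F \<omega> N e f j \<phi> \<and>
      dderiv \<omega> h \<phi> - L *v h \<phi> = V_rhs F \<omega> N e f j \<phi>)"
    using splitting_unique by metis
  finally show ?thesis by blast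
qed

lemma tangential_fourier_iff:
  fixes f g U :: "real^'m \<Rightarrow> real^'m"
  assumes "torus_smooth f" "torus_smooth g" "torus_smooth U"
  shows "(\<forall>\<phi>. dderiv \<omega> g \<phi> + f \<phi> = U \<phi>) \<longleftrightarrow>
    (\<forall>k. fcoeff f k = fcoeff U k - (\<i> * complex_of_real (\<omega> \<bullet> ivec k)) *s fcoeff g k)"
proof -
  have smooth: "torus_smooth (\<lambda>\<phi>. dderiv \<omega> g \<phi> + f \<phi>)"
    by (intro torus_smooth_add torus_smooth_dderiv assms)
  have "fcoeff (\<lambda>\<phi>. dderiv \<omega> g \<phi> + f \<phi>) k = (\<i> * complex_of_real (\<omega> \<bullet> ivec k)) *s fcoeff g k + fcoeff f k" for k
    by (simp add: fcoeff_add torus_smooth_dderiv fcoeff_dderiv assms)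
  then have "(\<forall>\<phi>. dderiv \<omega> g \<phi> + f \<phi> = U \<phi>) \<longleftrightarrow>
      (\<forall>k. (\<i> * complex_of_real (\<omega> \<bullet> ivec k)) *s fcoeff g k + fcoeff f k = fcoeff U k)"
    unfolding fcoeff_eq_iff[OF smooth assms(3)] by simp
  then show ?thesis
    by (simp add: eq_diff_eq add.commute)
qed

lemma normal_fourier_iff:
  fixes h V :: "real^'m \<Rightarrow> real^'n"
  assumes h: "torus_smooth h" and V: "torus_smooth V"
  shows "(\<forall>\<phi>. dderiv \<omega> h \<phi> - L *v h \<phi> = V \<phi>) \<longleftrightarrow>
    (\<forall>k. fcoeff h k = matrix_inv (resolvent_mat \<omega> L k) *v fcoeff V k)"
proof -
  have Lh: "torus_smooth (\<lambda>\<phi>. L *v h \<phi>)"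
    by (rule torus_smooth_bounded_linear[OF matrix_vector_mul_bounded_linear h])
  have smooth: "torus_smooth (\<lambda>\<phi>. dderiv \<omega> h \<phi> - L *v h \<phi>)"
    by (intro torus_smooth_diff torus_smooth_dderiv h Lh)
  have coeff: "fcoeff (\<lambda>\<phi>. dderiv \<omega> h \<phi> - L *v h \<phi>) k = resolvent_mat \<omega> L k *v fcoeff h k" for k
    using fcoeff_add[OF smooth Lh, of k] fcoeff_dderiv[OF h, of \<omega> k] fcoeff_matrix[OF h, of L k]
    by (simp add: resolvent_mat_def matrix_vector_mult_diff_rdistrib mat_matrix_vector)
  have "resolvent_mat \<omega> L k *v x = y \<longleftrightarrow> x = matrix_inv (resolvent_mat \<omega> L k) *v y" for k x y
    using matrix_inv_left[OF resolvent_invertible[OF hyperbolic]]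
      matrix_inv_right[OF resolvent_invertible[OF hyperbolic]]
    by (metis matrix_vector_mul_assoc matrix_vector_mul_lid)
  then have "(\<forall>k. fcoeff (\<lambda>\<phi>. dderiv \<omega> h \<phi> - L *v h \<phi>) k = fcoeff V k) \<longleftrightarrow>
      (\<forall>k. fcoeff h k = matrix_inv (resolvent_mat \<omega> L k) *v fcoeff V k)"
    by (simp only: coeff)
  then show ?thesis
    unfolding fcoeff_eq_iff[OF smooth V] .
qed

lemma iter_solution_iff_fourier:
  assumes lower: "lower_smooth e f j" and s: "splits e0 N (e j) g h" and fj: "torus_smooth (f j)"
  shows "iter_solution F \<omega> e f j \<longleftrightarrow>
    (\<forall>k. fcoeff (f j) k = fcoeff (U_rhs F \<omega> N e f j) k
                          - (\<i> * complex_of_real (\<omega> \<bullet> ivec k)) *s fcoeff g k \<and>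
         fcoeff h k = matrix_inv (resolvent_mat \<omega> L k) *v fcoeff (V_rhs F \<omega> N e f j) k)"
proof -
  have "torus_smooth g" "torus_smooth h" "torus_smooth (U_rhs F \<omega> N e f j)" "torus_smooth (V_rhs F \<omega> N e f j)"
    using s G_rhs_splits[OF lower] by (auto simp: splits_def)
  then show ?thesis
    using tangential_fourier_iff[OF fj] normal_fourier_iff
    by (simp add: iter_solution_iff[OF lower s fj] all_conj_distrib)
qed

lemma lower_smooth_cong:
  "(\<And>i. i < j \<Longrightarrow> e i = e' i \<and> f i = f' i) \<Longrightarrow> 1 \<le> j \<Longrightarrow> lower_smooth e f j \<longleftrightarrow> lower_smooth e' f' j"
  by (auto simp: lower_smooth_def)

lemma solution_step:
  assumes j: "1 \<le> j" and lower: "lower_smooth e f j" and g: "torus_smooth g"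
  obtains a b h where "splits e0 N a g h" "iter_solution F \<omega> (e(j := a)) (f(j := b)) j"
    "\<And>\<phi>. b \<phi> = U_rhs F \<omega> N e f j \<phi> - dderiv \<omega> g \<phi>"
proof -
  have UV: "torus_smooth (U_rhs F \<omega> N e f j)" "torus_smooth (V_rhs F \<omega> N e f j)"
    using G_rhs_splits[OF lower] by (auto simp: splits_def)
  obtain h where h: "torus_smooth h" "\<And>\<phi>. dderiv \<omega> h \<phi> - L *v h \<phi> = V_rhs F \<omega> N e f j \<phi>"
    using hyperbolic_flow_equation[OF hyperbolic UV(2)] by blast
  let ?a = "\<lambda>\<phi>. frechet_derivative e0 (at \<phi>) (g \<phi>) + N \<phi> *v h \<phi>"
    and ?b = "\<lambda>\<phi>. U_rhs F \<omega> N e f j \<phi> - dderiv \<omega> g \<phi>"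
  let ?e = "e(j := ?a)" and ?f = "f(j := ?b)"
  have s: "splits e0 N ?a g h"
    by (simp add: splits_def g h)
  have b: "torus_smooth ?b"
    by (intro torus_smooth_diff torus_smooth_dderiv UV g)
  have "lower_smooth ?e ?f j"
    using lower by (subst lower_smooth_cong[where e'=e and f'=f]) (use j in auto)
  \<comment> \<open>Installing the new order j leaves the right-hand side unchanged, so
    \<open>U_rhs\<close> and \<open>V_rhs\<close> could be computed before \<open>?a\<close> and
    \<open>?b\<close> were known.\<close>
  moreover have "G_rhs F \<omega> ?e ?f j = G_rhs F \<omega> e f j"
    by (rule G_rhs_cong) auto
  then have "U_rhs F \<omega> N ?e ?f j = U_rhs F \<omega> N e f j" "V_rhs F \<omega> N ?e ?f j = V_rhs F \<omega> N e f j"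
    using j by (auto simp: U_rhs_def V_rhs_def fun_eq_iff)
  ultimately have "iter_solution F \<omega> ?e ?f j"
    by (subst iter_solution_iff[where g=g and h=h]) (use s b h in auto)
  then show ?thesis
    using that[OF s] by simp
qed

lemma lower_smoothI:
  "e 0 = e0 \<Longrightarrow> (\<And>i. 1 \<le> i \<Longrightarrow> i < j \<Longrightarrow> iter_solution F \<omega> e f i) \<Longrightarrow> lower_smooth e f j"
  by (auto simp: lower_smooth_def iter_solution_def)

lemma solutions_exist:
  assumes g: "\<And>j. 1 \<le> j \<Longrightarrow> torus_smooth (g j)"
  shows "\<exists>e f h. e 0 = e0 \<and> (\<forall>j\<ge>1. iter_solution F \<omega> e f j \<and> splits e0 N (e j) (g j) (h j))"
proof -
  \<comment> \<open>\<open>r\<close> is the triple of order-j terms of e, f and h. The updates at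
    \<open>j\<close> make \<open>P s j r\<close> depend on \<open>s\<close> only below
    \<open>j\<close>, as well-founded dependent choice demands; at order 0 only e is
    prescribed.\<close>
  define P where "P s j r \<longleftrightarrow> (if j = 0 then fst r = e0
      else iter_solution F \<omega> ((fst \<circ> s)(j := fst r)) ((fst \<circ> snd \<circ> s)(j := fst (snd r))) j \<and>
        splits e0 N (fst r) (g j) (snd (snd r)))"
    for s :: "nat \<Rightarrow> (real^'m \<Rightarrow> real^'M) \<times> (real^'m \<Rightarrow> real^'m) \<times> (real^'m \<Rightarrow> real^'n)" and j r
  have "\<exists>s. \<forall>j. P s j (s j)"
  proof (rule dependent_wf_choice[OF wf_less])
    show "P s j r = P s' j r" if "\<And>i. (i, j) \<in> {(i, j). i < j} \<Longrightarrow> s i = s' i" for s s' j r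
    proof (cases "j = 0")
      case False
      then show ?thesis
        unfolding P_def
        using that by (simp, intro conj_cong[OF iter_solution_cong] refl) auto
    qed (simp add: P_def)
    show "\<exists>r. P s j r" if "\<And>i. (i, j) \<in> {(i, j). i < j} \<Longrightarrow> P s i (s i)" for s j
    proof (cases "j = 0")
      case True
      then show ?thesis by (simp add: P_def)
    next
      case False
      have "P s i (s i)" if "i < j" for i
        using that \<open>\<And>i. (i, j) \<in> {(i, j). i < j} \<Longrightarrow> P s i (s i)\<close> by blast
      moreover have "(fst \<circ> s)(i := fst (s i)) = fst \<circ> s"
        "(fst \<circ> snd \<circ> s)(i := fst (snd (s i))) = fst \<circ> snd \<circ> s" for i
        by (auto simp: fun_eq_iff)
      ultimately have lower: "lower_smooth (fst \<circ> s) (fst \<circ> snd \<circ> s) j"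
        using False by (intro lower_smoothI) (fastforce simp: P_def)+
      have j: "1 \<le> j"
        using False by simp
      obtain a b h where "splits e0 N a (g j) h"
        "iter_solution F \<omega> ((fst \<circ> s)(j := a)) ((fst \<circ> snd \<circ> s)(j := b)) j"
        "\<And>\<phi>. b \<phi> = U_rhs F \<omega> N (fst \<circ> s) (fst \<circ> snd \<circ> s) j \<phi> - dderiv \<omega> (g j) \<phi>"
        by (rule solution_step[OF j lower g[OF j]]) blast
      then have "P s j (a, b, h)"
        using False by (simp add: P_def)
      then show ?thesis ..
    qed
  qed
  then obtain s where s: "\<And>j. P s j (s j)" by blast
  have upd: "(fst \<circ> s)(i := fst (s i)) = fst \<circ> s"
    "(fst \<circ> snd \<circ> s)(i := fst (snd (s i))) = fst \<circ> snd \<circ> s" for i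
    by (auto simp: fun_eq_iff)
  have "(fst \<circ> s) 0 = e0"
    using s[of 0] by (simp add: P_def)
  moreover have "iter_solution F \<omega> (fst \<circ> s) (fst \<circ> snd \<circ> s) j \<and>
      splits e0 N ((fst \<circ> s) j) (g j) ((snd \<circ> snd \<circ> s) j)" if "1 \<le> j" for j
    using s[of j] that by (simp add: P_def upd)
  ultimately show ?thesis by blast
qed

text \<open>The induction must carry e and f, on which the next right-hand side depends. Below j
  equal tangential components give equal e and f; at j itself the tangential components may differ,
  and only the Fourier formula for h is used.\<close>

lemma normal_component_determined:
  assumes e: "e 0 = e0" "\<And>i. 1 \<le> i \<Longrightarrow> i \<le> j \<Longrightarrow> iter_solution F \<omega> e f i \<and> splits e0 N (e i) (g i) (h i)"
    and e': "e' 0 = e0" "\<And>i. 1 \<le> i \<Longrightarrow> i \<le> j \<Longrightarrow> iter_solution F \<omega> e' f' i \<and> splits e0 N (e' i) (g' i) (h' i)"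
    and g: "\<And>i. 1 \<le> i \<Longrightarrow> i < j \<Longrightarrow> g i = g' i"
    and j: "1 \<le> j"
  shows "h j = h' j"
proof -
  have step: "h i = h' i \<and> (g i = g' i \<longrightarrow> e i = e' i \<and> f i = f' i)"
    if i: "1 \<le> i" "i \<le> j" and below: "\<And>l. 1 \<le> l \<Longrightarrow> l < i \<Longrightarrow> e l = e' l \<and> f l = f' l" for i
  proof -
    have lower: "lower_smooth e f i" "lower_smooth e' f' i"
      using i e(2) e'(2) by (simp_all add: lower_smoothI[of e, OF e(1)] lower_smoothI[of e', OF e'(1)])
    have sol: "iter_solution F \<omega> e f i" "iter_solution F \<omega> e' f' i"
      and s: "splits e0 N (e i) (g i) (h i)" "splits e0 N (e' i) (g' i) (h' i)"
      using i e(2) e'(2) by auto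
    then have smooth: "torus_smooth (f i)" "torus_smooth (f' i)" "torus_smooth (h i)" "torus_smooth (h' i)"
      by (auto simp: iter_solution_def splits_def)
    have "e l = e' l" if "l < i" for l
      using below[of l] that e(1) e'(1) by (cases "l = 0") auto
    then have "G_rhs F \<omega> e f i = G_rhs F \<omega> e' f' i"
      using below by (intro G_rhs_cong) auto
    then have rhs: "U_rhs F \<omega> N e f i = U_rhs F \<omega> N e' f' i" "V_rhs F \<omega> N e f i = V_rhs F \<omega> N e' f' i"
      using e(1) e'(1) by (simp_all add: U_rhs_def[abs_def] V_rhs_def[abs_def])
    have "fcoeff (h i) k = fcoeff (h' i) k" for k
      using sol iter_solution_iff_fourier[OF lower(1) s(1) smooth(1)]
        iter_solution_iff_fourier[OF lower(2) s(2) smooth(2)] rhs by simp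
    then have h: "h i = h' i"
      using fcoeff_eqI[OF smooth(3,4)] by blast
    have "f i = f' i" if "g i = g' i"
    proof
      fix \<phi>
      show "f i \<phi> = f' i \<phi>"
        using sol iter_solution_iff[OF lower(1) s(1) smooth(1)]
          iter_solution_iff[OF lower(2) s(2) smooth(2)] rhs that by (metis add_left_cancel)
    qed
    moreover have "e i = e' i" if "g i = g' i"
      using that h s by (auto simp: splits_def)
    ultimately show ?thesis using h by blast
  qed
  have "e i = e' i \<and> f i = f' i" if "1 \<le> i" "i < j" for i
    using that
  proof (induction i rule: less_induct)
    case (less i)
    then show ?case
      using step[of i] g[of i] by simp
  qed
  then show ?thesis
    using step[of j] j by simp
qed

lemma normal_form_solution:
  assumes j: "1 \<le> j" and lower: "lower_smooth e f j"
  shows "\<exists>g h a b. splits e0 N a g h \<and> iter_solution F \<omega> (e(j := a)) (f(j := b)) j \<and>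
    normal_form \<omega> (enat K) b"
proof -
  let ?U = "U_rhs F \<omega> N e f j"
  have U: "torus_smooth ?U"
    using G_rhs_splits[OF lower] by (auto simp: splits_def)
  define S where "S = {k :: int^'m. \<omega> \<bullet> ivec k \<noteq> 0 \<and> norm (ivec k) \<le> real K}"
  \<comment> \<open>The choice solves U_k - i<omega,k> c_k = 0, which cancels the coefficient of
    \<open>b\<close> on \<open>S\<close>. Conjugate symmetry of \<open>c\<close> comes from U being
    real.\<close>
  define c where "c k = inverse (\<i> * complex_of_real (\<omega> \<bullet> ivec k)) *s fcoeff ?U k" for k
  have "finite S"
    by (rule finite_subset[OF _ finite_ivec_ball[of "real K"]]) (auto simp: S_def)
  moreover have "k \<in> S \<Longrightarrow> - k \<in> S" for k
    by (simp add: S_def ivec_minus)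
  then have "uminus ` S = S"
    by (metis image_subset_iff minus_minus subset_antisym subsetI image_eqI)
  moreover have "c (- k) $ i = cnj (c k $ i)" for k i
    by (simp add: c_def ivec_minus fcoeff_uminus)
  ultimately obtain g :: "real^'m \<Rightarrow> real^'m"
    where g: "torus_smooth g" "\<And>k. fcoeff g k = (if k \<in> S then c k else 0)"
    by (rule exists_trigonometric_polynomial) blast
  obtain a b h where abh: "splits e0 N a g h" "iter_solution F \<omega> (e(j := a)) (f(j := b)) j"
    and b: "\<And>\<phi>. b \<phi> = ?U \<phi> - dderiv \<omega> g \<phi>"
    by (rule solution_step[OF j lower g(1)]) blast
  have b_smooth: "torus_smooth b"
    using abh(2) by (simp add: iter_solution_def)
  have b_coeff: "fcoeff b k = fcoeff ?U k - (\<i> * complex_of_real (\<omega> \<bullet> ivec k)) *s fcoeff g k" for k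
    using tangential_fourier_iff[OF b_smooth g(1) U] b by simp
  have "normal_form \<omega> (enat K) b"
    unfolding normal_form_def
  proof (intro allI impI)
    fix k assume "\<omega> \<bullet> ivec k \<noteq> 0 \<and> ereal (norm (ivec k)) \<le> ereal_of_enat (enat K)"
    then have "k \<in> S" "\<omega> \<bullet> ivec k \<noteq> 0" by (auto simp: S_def)
    then show "fcoeff b k = 0"
      by (simp add: b_coeff g(2) c_def vec_eq_iff field_simps)
  qed
  with abh show ?thesis by blast
qed

end

theorem theorem4p1:
  fixes F :: "nat \<Rightarrow> real^'M \<Rightarrow> real^'M"
    and \<omega> :: "real^'m"
    and e0 :: "real^'m \<Rightarrow> real^'M"
    and N :: "real^'m \<Rightarrow> real^'n^'M"
    and L :: "real^'n^'n"
  assumes dim: "CARD('M::finite) = CARD('m::finite) + CARD('n::finite)"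
    and F_smooth: "\<And>j. smooth (F j)"
    and torus: "invariant_torus (F 0) \<omega> e0"
    and reducible: "reducible_by (F 0) \<omega> e0 N L"
    and hyperbolic: "hyperbolic_matrix L"
  shows
    \<comment> \<open>the decomposition of \<open>e\<^sub>j\<close> into tangential and normal components is well defined\<close>
    "(\<forall>a. torus_smooth a \<longrightarrow> (\<exists>!p. splits e0 N a (fst p) (snd p)))
     \<comment> \<open>(i)\<close>
     \<and> (\<exists>e f. e 0 = e0 \<and> (\<forall>j\<ge>1. iter_solution F \<omega> e f j))
     \<and> (\<forall>k. invertible (resolvent_mat \<omega> L k))
     \<and> (\<forall>e f g h. \<forall>j\<ge>1. e 0 = e0 \<and> (\<forall>i\<in>{1..j}. torus_smooth (e i) \<and> torus_smooth (f i)) \<and>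
          splits e0 N (e j) g h \<longrightarrow>
          (iter_solution F \<omega> e f j \<longleftrightarrow>
           (\<forall>k. fcoeff (f j) k = fcoeff (U_rhs F \<omega> N e f j) k
                                 - (\<i> * complex_of_real (\<omega> \<bullet> ivec k)) *s fcoeff g k \<and>
                fcoeff h k = matrix_inv (resolvent_mat \<omega> L k) *v fcoeff (V_rhs F \<omega> N e f j) k)))
     \<comment> \<open>(ii): the tangential components are free; the earlier ones determine the normal one\<close>
     \<and> (\<forall>g. (\<forall>j\<ge>1. torus_smooth (g j)) \<longrightarrow>
          (\<exists>e f h. e 0 = e0 \<and>
             (\<forall>j\<ge>1. iter_solution F \<omega> e f j \<and> splits e0 N (e j) (g j) (h j))))
     \<and> (\<forall>e f g h e' f' g' h'. \<forall>j\<ge>1.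
          e 0 = e0 \<and> e' 0 = e0 \<and>
          (\<forall>i\<in>{1..j}. iter_solution F \<omega> e f i \<and> splits e0 N (e i) (g i) (h i)) \<and>
          (\<forall>i\<in>{1..j}. iter_solution F \<omega> e' f' i \<and> splits e0 N (e' i) (g' i) (h' i)) \<and>
          (\<forall>i\<in>{1..<j}. g i = g' i) \<longrightarrow> h j = h' j)
     \<comment> \<open>(iii): whatever solution has been chosen for the orders below \<open>j\<close>\<close>
     \<and> (\<forall>e f. \<forall>j\<ge>1. \<forall>K::nat. e 0 = e0 \<and> (\<forall>i\<in>{1..<j}. iter_solution F \<omega> e f i) \<longrightarrow>
          (\<exists>g h a b. splits e0 N a g h \<and> iter_solution F \<omega> (e(j := a)) (f(j := b)) j \<and>
             normal_form \<omega> (enat K) b))"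
proof -
  interpret hyperbolic_torus F \<omega> e0 N L
    by unfold_locales (rule assms)+
  show ?thesis
  proof (intro conjI allI impI)
    show "\<exists>!p. splits e0 N a (fst p) (snd p)" if a: "torus_smooth a" for a
    proof -
      obtain g h where "splits e0 N a g h"
        by (rule split_exists[OF a])
      then show ?thesis
        using splits_unique by (intro ex1I[of _ "(g, h)"]) (auto simp: prod_eq_iff)
    qed
    show "\<exists>e f. e 0 = e0 \<and> (\<forall>j\<ge>1. iter_solution F \<omega> e f j)"
      using solutions_exist[of "\<lambda>j \<phi>. 0"] torus_smooth_const by blast
    show "invertible (resolvent_mat \<omega> L k)" for k
      by (rule resolvent_invertible[OF hyperbolic])
    show "iter_solution F \<omega> e f j \<longleftrightarrow>
           (\<forall>k. fcoeff (f j) k = fcoeff (U_rhs F \<omega> N e f j) k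
                                 - (\<i> * complex_of_real (\<omega> \<bullet> ivec k)) *s fcoeff g k \<and>
                fcoeff h k = matrix_inv (resolvent_mat \<omega> L k) *v fcoeff (V_rhs F \<omega> N e f j) k)"
      if "1 \<le> j" and "e 0 = e0 \<and> (\<forall>i\<in>{1..j}. torus_smooth (e i) \<and> torus_smooth (f i)) \<and> splits e0 N (e j) g h"
      for e f g h j
      using that by (intro iter_solution_iff_fourier) (auto simp: lower_smooth_def)
    show "\<exists>e f h. e 0 = e0 \<and> (\<forall>j\<ge>1. iter_solution F \<omega> e f j \<and> splits e0 N (e j) (g j) (h j))"
      if "\<forall>j\<ge>1. torus_smooth (g j)" for g
      using that by (intro solutions_exist) auto
    show "h j = h' j" if "1 \<le> j" and "e 0 = e0 \<and> e' 0 = e0 \<and>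
          (\<forall>i\<in>{1..j}. iter_solution F \<omega> e f i \<and> splits e0 N (e i) (g i) (h i)) \<and>
          (\<forall>i\<in>{1..j}. iter_solution F \<omega> e' f' i \<and> splits e0 N (e' i) (g' i) (h' i)) \<and>
          (\<forall>i\<in>{1..<j}. g i = g' i)" for e f g h e' f' g' h' j
      using that by (intro normal_component_determined[of e j f g h e' f' g' h']) auto
    show "\<exists>g h a b. splits e0 N a g h \<and> iter_solution F \<omega> (e(j := a)) (f(j := b)) j \<and>
             normal_form \<omega> (enat K) b"
      if "1 \<le> j" and "e 0 = e0 \<and> (\<forall>i\<in>{1..<j}. iter_solution F \<omega> e f i)" for e f j K
      using that by (intro normal_form_solution lower_smoothI) auto
  qed
qed

end
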